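(* Let $G$ be a probability distribution on $[0,\infty)$, let $\boldsymbol X=(X_0,X_1,\dots)$ be a homogeneous Markov chain on $[0,\infty)$ with transition kernel $K\in D(G)$, let $y(t)$ be a uniform extremal boundary for $K$, and let $\boldsymbol X^{(t)}$ be the extremal component of $\boldsymbol X$ relative to $t$ (defined using $y$). Let $\boldsymbol T^*$ be the tail chain $T^*_n=T^*_0\,\xi_1\cdots\xi_n$, $n\ge0$, where $\xi_1,\xi_2,\dots$ are iid with distribution $G$ and independent of $T^*_0$. Let $u_t=u(t)\ge0$ satisfy $u_t\to u>0$ as $t\to\infty$. Then for every $m\ge1$, as $t\to\infty$, $$\mathsf P_{tu_t}\Big[\Big(\tfrac{X^{(t)}_1}{t},\dots,\tfrac{X^{(t)}_m}{t}\Big)\in\cdot\,\Big]\Rightarrow\mathsf P_u\big[(T^*_1,\dots,T^*_m)\in\cdot\,\big]\quad\text{on }[0,\infty]^m.$$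
   Context: A Markov transition kernel $K:[0,\infty)\times\mathcal B[0,\infty)\to[0,1]$ is in the domain of attraction of $G$, written $K\in D(G)$, if $K(t,t\,\cdot)\Rightarrow G(\cdot)$ on $[0,\infty]$ as $t\to\infty$ (weak convergence; $tA=\{ta:a\in A\}$). An extremal boundary for $K\in D(G)$ is a non-negative function $y(t)$ on $[0,\infty)$ with $\lim_{t\to\infty}y(t)=0$ and $K(t,t[0,y(t)])\to G(\{0\})$ as $t\to\infty$; it is a uniform extremal boundary if moreover $K(tu_t,t[0,y(t)])\to G(\{0\})$ for every non-negative function $u_t\to u>0$. Put $\tau(t)=\inf\{n\ge0: X_n\le t\,y(t)\}$. The extremal component of $\boldsymbol X$ relative to $t>0$ is the process $X^{(t)}_n=X_n\cdot\mathbf 1_{\{n<\tau(t)\}}$, $n=0,1,\dots$. $\mathsf P_x$ denotes conditional probability given that the initial state ($X_0$, respectively $T_0^*$) equals $x$. *)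

theory Defs
  imports "HOL-Probability.Probability" "HOL-Library.Extended_Nat"
begin

abbreviation nonneg_borel :: "real measure" where
  "nonneg_borel \<equiv> restrict_space borel {0..}"

text \<open>Weak convergence of Borel probability measures on a topological space \<open>S\<close>, along a filter.
  The weak convergence of \<^theory>\<open>HOL-Probability.Weak_Convergence\<close> covers only sequences of
  distributions on the real line.\<close>

definition weak_conv_along ::
    "'s topology \<Rightarrow> ('t \<Rightarrow> 's measure) \<Rightarrow> 's measure \<Rightarrow> 't filter \<Rightarrow> bool" where
  "weak_conv_along S M N F \<longleftrightarrow>
     (\<forall>f :: 's \<Rightarrow> real. continuous_map S euclideanreal f \<and> bounded (f ` topspace S) \<longrightarrow>
        ((\<lambda>t. \<integral>x. f x \<partial>M t) \<longlongrightarrow> (\<integral>x. f x \<partial>N)) F)"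

text \<open>\<open>K(t, t\<cdot>) \<Rightarrow> G\<close> on \<open>[0,\<infinity>]\<close>: the measure \<open>K(t, t\<cdot>)\<close> is the image of \<open>K(t, \<cdot>)\<close> under
  \<open>x \<mapsto> x/t\<close>, and \<open>[0,\<infinity>]\<close> is the (compact) type \<^typ>\<open>ennreal\<close>.\<close>

definition in_domain_of_attraction :: "(real \<Rightarrow> real measure) \<Rightarrow> real measure \<Rightarrow> bool" where
  "in_domain_of_attraction K G \<longleftrightarrow>
     weak_conv_along (euclidean :: ennreal topology)
       (\<lambda>t. distr (K t) borel (\<lambda>x. ennreal (x / t))) (distr G borel ennreal) at_top"

definition extremal_boundary ::
    "(real \<Rightarrow> real measure) \<Rightarrow> real measure \<Rightarrow> (real \<Rightarrow> real) \<Rightarrow> bool" where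
  "extremal_boundary K G y \<longleftrightarrow>
     (\<forall>t\<ge>0. 0 \<le> y t) \<and> (y \<longlongrightarrow> 0) at_top \<and>
     ((\<lambda>t. measure (K t) ((*) t ` {0..y t})) \<longlongrightarrow> measure G {0}) at_top"

definition uniform_extremal_boundary ::
    "(real \<Rightarrow> real measure) \<Rightarrow> real measure \<Rightarrow> (real \<Rightarrow> real) \<Rightarrow> bool" where
  "uniform_extremal_boundary K G y \<longleftrightarrow>
     extremal_boundary K G y \<and>
     (\<forall>u v. (\<forall>t\<ge>0. 0 \<le> u t) \<and> 0 < v \<and> (u \<longlongrightarrow> v) at_top \<longrightarrow>
        ((\<lambda>t. measure (K (t * u t)) ((*) t ` {0..y t})) \<longlongrightarrow> measure G {0}) at_top)"

text \<open>The infimum is taken in \<^typ>\<open>enat\<close>, so that \<open>\<tau>(t) = \<infinity>\<close> if the boundary is never crossed.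
  Both definitions act on a path \<open>x\<close> of the chain.\<close>

definition crossing_time :: "(real \<Rightarrow> real) \<Rightarrow> real \<Rightarrow> (nat \<Rightarrow> real) \<Rightarrow> enat" where
  "crossing_time y t x = Inf {enat n | n. x n \<le> t * y t}"

definition extremal_component ::
    "(real \<Rightarrow> real) \<Rightarrow> real \<Rightarrow> (nat \<Rightarrow> real) \<Rightarrow> nat \<Rightarrow> real" where
  "extremal_component y t x n = x n * (if enat n < crossing_time y t x then 1 else 0)"

definition natural_history :: "'a measure \<Rightarrow> (nat \<Rightarrow> 'a \<Rightarrow> real) \<Rightarrow> nat \<Rightarrow> 'a measure" where
  "natural_history \<Omega> X n =
     vimage_algebra (space \<Omega>) (\<lambda>\<omega>. \<lambda>k\<in>{..n}. X k \<omega>) (Pi\<^sub>M {..n} (\<lambda>_. nonneg_borel))"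

text \<open>A homogeneous Markov chain on \<open>[0,\<infinity>)\<close> together with its conditional laws \<open>P x\<close> given
  \<open>X 0 = x\<close>. Since the initial states \<open>t u\<^sub>t\<close> are arbitrary points, these laws have to be given for
  every \<open>x\<close>, not just almost everywhere; hence the usual family \<open>(\<Omega>, (P x)\<^sub>x, X)\<close>. The measure
  \<open>\<Omega>\<close> serves only as a carrier of the sample space and its \<open>\<sigma>\<close>-algebra.\<close>

definition markov_chain_family ::
    "'a measure \<Rightarrow> (real \<Rightarrow> real measure) \<Rightarrow> (real \<Rightarrow> 'a measure) \<Rightarrow> (nat \<Rightarrow> 'a \<Rightarrow> real) \<Rightarrow> bool" where
  "markov_chain_family \<Omega> K P X \<longleftrightarrow>
     (\<forall>n. X n \<in> \<Omega> \<rightarrow>\<^sub>M nonneg_borel) \<and>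
     (\<forall>x\<ge>0. P x \<in> space (prob_algebra \<Omega>) \<and>
        (AE \<omega> in P x. X 0 \<omega> = x) \<and>
        (\<forall>n. \<forall>A \<in> sets nonneg_borel. AE \<omega> in P x.
           real_cond_exp (P x) (natural_history \<Omega> X n)
             (indicator {\<omega> \<in> space \<Omega>. X (Suc n) \<omega> \<in> A}) \<omega> = measure (K (X n \<omega>)) A))"

text \<open>The tail chain \<open>T n = T 0 \<cdot> \<xi> 1 \<cdots> \<xi> n\<close>, likewise with its conditional laws \<open>Q x\<close> given
  \<open>T 0 = x\<close>; only the \<open>\<xi> i\<close> with \<open>i \<ge> 1\<close> play a role. The single
  independence condition on \<open>T 0, \<xi> 1, \<xi> 2, \<dots>\<close> says both that the \<open>\<xi> i\<close> are independent and that
  the sequence is independent of \<open>T 0\<close>.\<close>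

definition tail_chain_family ::
    "'b measure \<Rightarrow> real measure \<Rightarrow> (real \<Rightarrow> 'b measure) \<Rightarrow> (nat \<Rightarrow> 'b \<Rightarrow> real) \<Rightarrow>
     (nat \<Rightarrow> 'b \<Rightarrow> real) \<Rightarrow> bool" where
  "tail_chain_family \<Omega> G Q T \<xi> \<longleftrightarrow>
     T 0 \<in> \<Omega> \<rightarrow>\<^sub>M nonneg_borel \<and>
     (\<forall>i\<ge>1. \<xi> i \<in> \<Omega> \<rightarrow>\<^sub>M nonneg_borel) \<and>
     (\<forall>n. \<forall>\<omega>\<in>space \<Omega>. T n \<omega> = T 0 \<omega> * (\<Prod>i=1..n. \<xi> i \<omega>)) \<and>
     (\<forall>x\<ge>0. Q x \<in> space (prob_algebra \<Omega>) \<and>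
        (AE \<omega> in Q x. T 0 \<omega> = x) \<and>
        (\<forall>i\<ge>1. distr (Q x) nonneg_borel (\<xi> i) = G) \<and>
        prob_space.indep_vars (Q x) (\<lambda>_. nonneg_borel)
          (\<lambda>i. if i = 0 then T 0 else \<xi> i) UNIV)"

text \<open>The law on \<open>[0,\<infinity>]\<^sup>m\<close> of \<open>(Y 1, \<dots>, Y m)\<close>, where \<open>Y\<close> is a nonnegative process.\<close>

definition joint_law ::
    "nat \<Rightarrow> 'a measure \<Rightarrow> (nat \<Rightarrow> 'a \<Rightarrow> real) \<Rightarrow> (nat \<Rightarrow> ennreal) measure" where
  "joint_law m M Y =
     distr M (Pi\<^sub>M {1..m} (\<lambda>_. borel)) (\<lambda>\<omega>. \<lambda>n\<in>{1..m}. ennreal (Y n \<omega>))"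

end

theory Submission
  imports Defs
begin

text \<open>
  Fix a sequence \<open>t\<^sub>n \<rightarrow> \<infinity>\<close>. The extremal component divided by \<open>t\<^sub>n\<close> is a Markov chain that is killed, that
  is, sent to \<open>0\<close>, as soon as it falls below \<open>y(t\<^sub>n)\<close>. Consider one step from states \<open>a\<^sub>n \<rightarrow> l > 0\<close>. With
  \<open>s\<^sub>n = t\<^sub>n a\<^sub>n\<close>, the laws \<open>K(s\<^sub>n, s\<^sub>n\<cdot>)\<close> converge to \<open>G\<close>, so by Skorohod's theorem the new states
  may be taken to converge pointwise. Where the limit is positive the killing has no effect eventually;
  where it is \<open>0\<close>, the uniform extremal boundary says that the killed states equal \<open>0\<close> except with
  vanishing probability. Hence integrals of bounded functions \<open>h\<^sub>n\<close> against the killed kernels converge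
  to that of \<open>h\<close> as soon as \<open>h\<^sub>n(z\<^sub>n) \<rightarrow> h(z)\<close> for all \<open>z\<^sub>n \<rightarrow> z\<close> which are eventually \<open>0\<close> if \<open>z = 0\<close>,
  and the integrals, as functions of the starting point, converge in the same sense. So the
  statement can be iterated along the path.
\<close>

section \<open>Integration along one step of a chain\<close>

lemma space_nonneg_borel [simp]: "space nonneg_borel = {0..}"
  by (simp add: space_restrict_space)

lemma measurable_nonneg_borel_times:
  "f \<in> M \<rightarrow>\<^sub>M nonneg_borel \<Longrightarrow> g \<in> M \<rightarrow>\<^sub>M nonneg_borel \<Longrightarrow> (\<lambda>x. f x * g x) \<in> M \<rightarrow>\<^sub>M nonneg_borel"
  by (auto simp: measurable_restrict_space2_iff Pi_iff)

text \<open>The bind is the join of the image of \<open>M\<close> under \<open>\<kappa>\<close>, so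
  the integral first becomes an integral over measures and then, by the image formula, over
  \<open>M\<close>. Boundedness of \<open>f\<close> takes care of integrability throughout.\<close>

lemma integral_bind_prob_algebra:
  fixes f :: "'b \<Rightarrow> real"
  assumes M: "prob_space M" and \<kappa>: "\<kappa> \<in> M \<rightarrow>\<^sub>M prob_algebra N"
    and f: "f \<in> borel_measurable N" and bd: "\<And>x. x \<in> space N \<Longrightarrow> \<bar>f x\<bar> \<le> C"
  shows "(\<integral>x. f x \<partial>(M \<bind> \<kappa>)) = (\<integral>\<omega>. (\<integral>x. f x \<partial>\<kappa> \<omega>) \<partial>M)"
proof -
  interpret prob_space M by fact
  have \<kappa>' [measurable]: "\<kappa> \<in> M \<rightarrow>\<^sub>M subprob_algebra N"
    using \<kappa> by (rule measurable_prob_algebraD)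
  have "(\<integral>x. f x \<partial>(M \<bind> \<kappa>)) = (\<integral>x. f x \<partial>join (distr M (subprob_algebra N) \<kappa>))"
    by (simp add: bind_nonempty''[OF \<kappa>' not_empty])
  also have "\<dots> = (\<integral>L. integral\<^sup>L L f \<partial>distr M (subprob_algebra N) \<kappa>)"
  proof (rule integral_join[OF f bd])
    show "finite_measure (distr M (subprob_algebra N) \<kappa>)"
      by (rule finite_measure_distr) simp
    show "AE L in distr M (subprob_algebra N) \<kappa>. emeasure L (space L) \<le> ennreal 1"
      by (auto simp: AE_distr_iff space_subprob_algebra subprob_space.subprob_emeasure_le_1
          intro!: AE_I2 dest: measurable_space[OF \<kappa>'])
  qed simp_all
  also have "\<dots> = (\<integral>\<omega>. (\<integral>x. f x \<partial>\<kappa> \<omega>) \<partial>M)"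
    by (rule integral_distr[OF \<kappa>']) (rule integral_measurable_subprob_algebra[OF f])
  finally show ?thesis .
qed

text \<open>Rectangles form an intersection-stable generator of the product sigma-algebra, so a
  conditional law of \<open>Y\<close> that is known only through rectangles already determines
  integrals of functions of the pair. The kernel is indexed by \<open>\<omega>\<close> instead of
  the value of \<open>W\<close>, which fits both the Markov chain, where it depends on the present
  state, and the tail chain, where it is constant.\<close>

lemma integral_disintegration:
  fixes \<phi> :: "'b \<times> 'c \<Rightarrow> real"
  assumes M: "prob_space M"
    and W [measurable]: "W \<in> M \<rightarrow>\<^sub>M E" and Y [measurable]: "Y \<in> M \<rightarrow>\<^sub>M N"
    and \<kappa>: "\<kappa> \<in> M \<rightarrow>\<^sub>M prob_algebra N"
    and eq: "\<And>B A. B \<in> sets E \<Longrightarrow> A \<in> sets N \<Longrightarrow>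
      measure M {\<omega> \<in> space M. W \<omega> \<in> B \<and> Y \<omega> \<in> A} = (\<integral>\<omega>. indicator B (W \<omega>) * measure (\<kappa> \<omega>) A \<partial>M)"
    and \<phi> [measurable]: "\<phi> \<in> borel_measurable (E \<Otimes>\<^sub>M N)"
    and bd: "\<And>x. \<bar>\<phi> x\<bar> \<le> C"
  shows "(\<integral>\<omega>. \<phi> (W \<omega>, Y \<omega>) \<partial>M) = (\<integral>\<omega>. (\<integral>z. \<phi> (W \<omega>, z) \<partial>\<kappa> \<omega>) \<partial>M)"
proof -
  interpret prob_space M by fact
  have \<kappa>' [measurable]: "\<kappa> \<in> M \<rightarrow>\<^sub>M subprob_algebra N"
    using \<kappa> by (rule measurable_prob_algebraD)
  note \<kappa> [measurable]
  have \<kappa>_prob: "prob_space (\<kappa> \<omega>)" and sets_\<kappa>: "sets (\<kappa> \<omega>) = sets N" if "\<omega> \<in> space M" for \<omega>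
    using measurable_space[OF \<kappa> that] by (auto simp: space_prob_algebra)
  \<comment> \<open>\<open>L \<omega>\<close> is the product of the point mass at
    \<open>W \<omega>\<close> and \<open>\<kappa> \<omega>\<close>. Its mixture over
    \<open>M\<close> is the candidate for the joint law of \<open>W\<close> and
    \<open>Y\<close>.\<close>
  define L where "L \<omega> = distr (\<kappa> \<omega>) (E \<Otimes>\<^sub>M N) (Pair (W \<omega>))" for \<omega>
  have L: "L \<in> M \<rightarrow>\<^sub>M prob_algebra (E \<Otimes>\<^sub>M N)"
    unfolding L_def by measurable
  have Pair_meas: "Pair (W \<omega>) \<in> \<kappa> \<omega> \<rightarrow>\<^sub>M E \<Otimes>\<^sub>M N" if "\<omega> \<in> space M" for \<omega>
    using measurable_space[OF W that] sets_\<kappa>[OF that] by (simp add: measurable_Pair1' cong: measurable_cong_sets)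
  have "distr M (E \<Otimes>\<^sub>M N) (\<lambda>\<omega>. (W \<omega>, Y \<omega>)) = M \<bind> L"
  proof (rule measure_eqI_generator_eq[OF Int_stable_pair_measure_generator pair_measure_closed])
    show "sets (distr M (E \<Otimes>\<^sub>M N) (\<lambda>\<omega>. (W \<omega>, Y \<omega>))) =
      sigma_sets (space E \<times> space N) {a \<times> b |a b. a \<in> sets E \<and> b \<in> sets N}"
      by (simp add: sets_pair_measure)
    show "sets (M \<bind> L) = sigma_sets (space E \<times> space N) {a \<times> b |a b. a \<in> sets E \<and> b \<in> sets N}"
      using not_empty by (subst sets_bind[where N="E \<Otimes>\<^sub>M N"]) (auto simp: L_def sets_pair_measure)
    show "range (\<lambda>_::nat. space E \<times> space N) \<subseteq> {a \<times> b |a b. a \<in> sets E \<and> b \<in> sets N}"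
      by auto
    fix X assume "X \<in> {a \<times> b |a b. a \<in> sets E \<and> b \<in> sets N}"
    then obtain B A where X: "X = B \<times> A" and B [measurable]: "B \<in> sets E" and A [measurable]: "A \<in> sets N"
      by auto
    have "emeasure (distr M (E \<Otimes>\<^sub>M N) (\<lambda>\<omega>. (W \<omega>, Y \<omega>))) X
        = emeasure M {\<omega> \<in> space M. W \<omega> \<in> B \<and> Y \<omega> \<in> A}"
      unfolding X by (subst emeasure_distr) (auto intro!: arg_cong[where f="emeasure M"])
    also have "\<dots> = ennreal (\<integral>\<omega>. indicator B (W \<omega>) * measure (\<kappa> \<omega>) A \<partial>M)"
      by (simp add: emeasure_eq_measure eq)
    also have "\<dots> = (\<integral>\<^sup>+\<omega>. ennreal (indicator B (W \<omega>) * measure (\<kappa> \<omega>) A) \<partial>M)"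
    proof (rule nn_integral_eq_integral[symmetric])
      show "integrable M (\<lambda>\<omega>. indicator B (W \<omega>) * measure (\<kappa> \<omega>) A)"
        by (rule integrable_const_bound[where B=1])
           (auto intro!: AE_I2 simp: indicator_def prob_space.prob_le_1[OF \<kappa>_prob])
    qed auto
    also have "\<dots> = (\<integral>\<^sup>+\<omega>. emeasure (L \<omega>) X \<partial>M)"
    proof (rule nn_integral_cong)
      fix \<omega> assume \<omega>: "\<omega> \<in> space M"
      interpret k: prob_space "\<kappa> \<omega>" by (rule \<kappa>_prob[OF \<omega>])
      have "Pair (W \<omega>) -` X \<inter> space (\<kappa> \<omega>) = (if W \<omega> \<in> B then A else {})"
        using sets.sets_into_space[OF A] sets_eq_imp_space_eq[OF sets_\<kappa>[OF \<omega>]] by (auto simp: X)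
      then show "ennreal (indicator B (W \<omega>) * measure (\<kappa> \<omega>) A) = emeasure (L \<omega>) X"
        by (simp add: L_def X emeasure_distr[OF Pair_meas[OF \<omega>]] k.emeasure_eq_measure)
    qed
    also have "\<dots> = emeasure (M \<bind> L) X"
      using L not_empty by (subst emeasure_bind[where N="E \<Otimes>\<^sub>M N"]) (auto intro: measurable_prob_algebraD simp: X)
    finally show "emeasure (distr M (E \<Otimes>\<^sub>M N) (\<lambda>\<omega>. (W \<omega>, Y \<omega>))) X = emeasure (M \<bind> L) X" .
  next
    interpret D: prob_space "distr M (E \<Otimes>\<^sub>M N) (\<lambda>\<omega>. (W \<omega>, Y \<omega>))"
      by (rule prob_space_distr) simp
    show "emeasure (distr M (E \<Otimes>\<^sub>M N) (\<lambda>\<omega>. (W \<omega>, Y \<omega>))) (space E \<times> space N) \<noteq> \<infinity>"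
      by simp
  qed auto
  then have "(\<integral>\<omega>. \<phi> (W \<omega>, Y \<omega>) \<partial>M) = (\<integral>p. \<phi> p \<partial>(M \<bind> L))"
    by (simp add: integral_distr flip: \<open>distr _ _ _ = _\<close>)
  also have "\<dots> = (\<integral>\<omega>. (\<integral>p. \<phi> p \<partial>L \<omega>) \<partial>M)"
    by (rule integral_bind_prob_algebra[OF M L \<phi> bd])
  also have "\<dots> = (\<integral>\<omega>. (\<integral>z. \<phi> (W \<omega>, z) \<partial>\<kappa> \<omega>) \<partial>M)"
    unfolding L_def by (intro Bochner_Integration.integral_cong refl integral_distr Pair_meas \<phi>)
  finally show ?thesis .
qed

text \<open>The Markov property in the definition concerns indicators of the next state and
  conditional expectations. Integrating it over events of the past gives the rectangle formula, and
  disintegration extends this to bounded functions of the past and the next state.\<close>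

lemma markov_chain_integral:
  fixes \<phi> :: "(nat \<Rightarrow> real) \<times> real \<Rightarrow> real"
  assumes mc: "markov_chain_family \<Omega> K P X" and K [measurable]: "K \<in> nonneg_borel \<rightarrow>\<^sub>M prob_algebra nonneg_borel"
    and x: "0 \<le> x"
    and \<phi>: "\<phi> \<in> borel_measurable (Pi\<^sub>M {..n} (\<lambda>_. nonneg_borel) \<Otimes>\<^sub>M nonneg_borel)"
    and bd: "\<And>p. \<bar>\<phi> p\<bar> \<le> C"
  shows "(\<integral>\<omega>. \<phi> (\<lambda>k\<in>{..n}. X k \<omega>, X (Suc n) \<omega>) \<partial>P x)
    = (\<integral>\<omega>. (\<integral>z. \<phi> (\<lambda>k\<in>{..n}. X k \<omega>, z) \<partial>K (X n \<omega>)) \<partial>P x)"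
proof -
  let ?E = "Pi\<^sub>M {..n} (\<lambda>_. nonneg_borel)"
  let ?F = "natural_history \<Omega> X n"
  have sets_P: "sets (P x) = sets \<Omega>" and P: "prob_space (P x)"
    using mc x by (auto simp: markov_chain_family_def space_prob_algebra)
  note [measurable_cong] = sets_P
  have space_P: "space (P x) = space \<Omega>" using sets_P by (rule sets_eq_imp_space_eq)
  interpret prob_space "P x" by fact
  have X [measurable]: "X k \<in> \<Omega> \<rightarrow>\<^sub>M nonneg_borel" for k
    using mc by (auto simp: markov_chain_family_def)
  let ?W = "\<lambda>\<omega>. \<lambda>k\<in>{..n}. X k \<omega>"
  have W: "?W \<in> \<Omega> \<rightarrow>\<^sub>M ?E"
    by (intro measurable_restrict X)
  have sub: "subalgebra (P x) ?F"
    unfolding subalgebra_def natural_history_def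
    using measurable_sets[OF W] by (auto simp: space_P sets_P sets_vimage_algebra intro!: sets.sigma_sets_subset)
  then interpret finite_measure_subalgebra "P x" ?F
    by unfold_locales
  show ?thesis
  proof (rule integral_disintegration[OF P _ _ _ _ \<phi> bd])
    show "?W \<in> P x \<rightarrow>\<^sub>M ?E" using W by simp
    show "X (Suc n) \<in> P x \<rightarrow>\<^sub>M nonneg_borel" by simp
    show "(\<lambda>\<omega>. K (X n \<omega>)) \<in> P x \<rightarrow>\<^sub>M prob_algebra nonneg_borel" by measurable
    fix B A assume B: "B \<in> sets ?E" and A [measurable]: "A \<in> sets nonneg_borel"
    \<comment> \<open>This event belongs to the natural history, so over it the indicator of the
      next state may be exchanged for its conditional expectation.\<close>
    let ?B = "?W -` B \<inter> space \<Omega>"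
    have B': "?B \<in> sets ?F"
      unfolding natural_history_def by (rule in_vimage_algebra[OF B])
    have B'' [measurable]: "?B \<in> sets \<Omega>" using measurable_sets[OF W B] .
    let ?I = "indicator {\<omega> \<in> space \<Omega>. X (Suc n) \<omega> \<in> A} :: _ \<Rightarrow> real"
    have "measure (P x) {\<omega> \<in> space (P x). ?W \<omega> \<in> B \<and> X (Suc n) \<omega> \<in> A}
        = (\<integral>\<omega>. indicator {\<omega> \<in> space (P x). ?W \<omega> \<in> B \<and> X (Suc n) \<omega> \<in> A} \<omega> \<partial>P x)"
      by (simp add: Int_absorb2 subset_iff)
    also have "\<dots> = (\<integral>\<omega>\<in>?B. ?I \<omega> \<partial>P x)"
      unfolding set_lebesgue_integral_def
      by (intro Bochner_Integration.integral_cong refl) (auto simp: indicator_def space_P)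
    also have "\<dots> = (\<integral>\<omega>\<in>?B. real_cond_exp (P x) ?F ?I \<omega> \<partial>P x)"
    proof (rule real_cond_exp_intA[OF _ B'])
      have "{\<omega> \<in> space \<Omega>. X (Suc n) \<omega> \<in> A} \<in> sets \<Omega>" by measurable
      then show "integrable (P x) ?I"
        by (intro integrable_const_bound[where B=1]) (auto simp: indicator_def)
    qed
    also have "\<dots> = (\<integral>\<omega>. indicator B (?W \<omega>) * measure (K (X n \<omega>)) A \<partial>P x)"
      unfolding set_lebesgue_integral_def
    proof (rule integral_cong_AE)
      have "AE \<omega> in P x. real_cond_exp (P x) ?F ?I \<omega> = measure (K (X n \<omega>)) A"
        using mc x A by (auto simp: markov_chain_family_def)
      then show "AE \<omega> in P x. indicat_real ?B \<omega> *\<^sub>R real_cond_exp (P x) ?F ?I \<omega>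
          = indicator B (?W \<omega>) * measure (K (X n \<omega>)) A"
        using AE_space by eventually_elim (auto simp: indicator_def space_P)
      show "(\<lambda>\<omega>. indicat_real ?B \<omega> *\<^sub>R real_cond_exp (P x) ?F ?I \<omega>) \<in> borel_measurable (P x)"
        by measurable
      have [measurable]: "?W \<in> P x \<rightarrow>\<^sub>M ?E" using W by simp
      show "(\<lambda>\<omega>. indicator B (?W \<omega>) * measure (K (X n \<omega>)) A) \<in> borel_measurable (P x)"
        using B A by measurable
    qed
    finally show "measure (P x) {\<omega> \<in> space (P x). ?W \<omega> \<in> B \<and> X (Suc n) \<omega> \<in> A}
      = (\<integral>\<omega>. indicator B (?W \<omega>) * measure (K (X n \<omega>)) A \<partial>P x)" .
  qed
qed

text \<open>The variables \<open>T 0, ..., T n\<close> are functions of \<open>T 0\<close> and the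
  first \<open>n\<close> factors, hence independent of the factor \<open>\<xi> (Suc n)\<close>. This
  is the disintegration with the constant kernel \<open>G\<close>.\<close>

lemma tail_chain_integral:
  fixes \<phi> :: "(nat \<Rightarrow> real) \<times> real \<Rightarrow> real"
  assumes tc: "tail_chain_family \<Omega> G Q T \<xi>" and G: "G \<in> space (prob_algebra nonneg_borel)"
    and x: "0 \<le> x"
    and \<phi>: "\<phi> \<in> borel_measurable (Pi\<^sub>M {..n} (\<lambda>_. nonneg_borel) \<Otimes>\<^sub>M nonneg_borel)"
    and bd: "\<And>p. \<bar>\<phi> p\<bar> \<le> C"
  shows "(\<integral>\<omega>. \<phi> (\<lambda>k\<in>{..n}. T k \<omega>, \<xi> (Suc n) \<omega>) \<partial>Q x)
    = (\<integral>\<omega>. (\<integral>z. \<phi> (\<lambda>k\<in>{..n}. T k \<omega>, z) \<partial>G) \<partial>Q x)"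
proof -
  let ?E = "Pi\<^sub>M {..n} (\<lambda>_. nonneg_borel)"
  have sets_Q: "sets (Q x) = sets \<Omega>" and Q: "prob_space (Q x)"
    and indep: "prob_space.indep_vars (Q x) (\<lambda>_. nonneg_borel) (\<lambda>i. if i = 0 then T 0 else \<xi> i) UNIV"
    and \<xi>_distr: "\<And>i. i \<ge> 1 \<Longrightarrow> distr (Q x) nonneg_borel (\<xi> i) = G"
    and T_eq: "\<And>n \<omega>. \<omega> \<in> space \<Omega> \<Longrightarrow> T n \<omega> = T 0 \<omega> * (\<Prod>i=1..n. \<xi> i \<omega>)"
    and T0 [measurable]: "T 0 \<in> \<Omega> \<rightarrow>\<^sub>M nonneg_borel"
    and \<xi>: "\<And>i. 1 \<le> i \<Longrightarrow> \<xi> i \<in> \<Omega> \<rightarrow>\<^sub>M nonneg_borel"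
    using tc x unfolding tail_chain_family_def space_prob_algebra by blast+
  note [measurable_cong] = sets_Q
  have space_Q: "space (Q x) = space \<Omega>" using sets_Q by (rule sets_eq_imp_space_eq)
  interpret prob_space "Q x" by fact
  define Z where "Z i = (if i = 0 then T 0 else \<xi> i)" for i
  \<comment> \<open>\<open>\<Phi>\<close> rebuilds the path of partial products from the independent
    family \<open>Z\<close>, in which the initial state occupies index \<open>0\<close>.\<close>
  define \<Phi> where "\<Phi> w = (\<lambda>k\<in>{..n}. w 0 * (\<Prod>i=1..k. w i))" for w :: "nat \<Rightarrow> real"
  have \<Phi> [measurable]: "\<Phi> \<in> ?E \<rightarrow>\<^sub>M ?E"
    unfolding \<Phi>_def
  proof (intro measurable_restrict)
    fix k assume k: "k \<in> {..n}"
    have "(\<lambda>w. w i) \<in> ?E \<rightarrow>\<^sub>M nonneg_borel" if "i \<in> {..n}" for i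
      using that by measurable
    then have m: "(\<lambda>w. w i) \<in> borel_measurable ?E" if "i \<in> {..n}" for i
      using that by (auto simp: measurable_restrict_space2_iff)
    show "(\<lambda>w. w 0 * (\<Prod>i=1..k. w i)) \<in> ?E \<rightarrow>\<^sub>M nonneg_borel"
      using k by (intro measurable_restrict_space2 borel_measurable_times borel_measurable_prod m)
        (auto simp: space_PiM PiE_iff intro!: mult_nonneg_nonneg prod_nonneg)
  qed
  have W_eq: "(\<lambda>k\<in>{..n}. T k \<omega>) = \<Phi> (\<lambda>i\<in>{..n}. Z i \<omega>)" if "\<omega> \<in> space \<Omega>" for \<omega>
    unfolding \<Phi>_def
  proof (rule restrict_ext)
    fix k assume k: "k \<in> {..n}"
    have "(\<Prod>i=1..k. \<xi> i \<omega>) = (\<Prod>i=1..k. (\<lambda>i\<in>{..n}. Z i \<omega>) i)"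
      using k by (intro prod.cong) (auto simp: Z_def)
    then show "T k \<omega> = (\<lambda>i\<in>{..n}. Z i \<omega>) 0 * (\<Prod>i=1..k. (\<lambda>i\<in>{..n}. Z i \<omega>) i)"
      using T_eq[OF that, of k] by (simp add: Z_def)
  qed
  \<comment> \<open>Independence of blocks is available for restrictions of the family to disjoint
    index sets, so the single factor is treated as a block over a one-element set and unpacked
    below.\<close>
  let ?E' = "Pi\<^sub>M {Suc n} (\<lambda>_. nonneg_borel)"
  let ?V = "\<lambda>\<omega>. \<lambda>i\<in>{..n}. Z i \<omega>" and ?V' = "\<lambda>\<omega>. \<lambda>i\<in>{Suc n}. Z i \<omega>"
  have ind: "indep_var ?E ?V ?E' ?V'"
    using indep unfolding Z_def by (rule indep_var_restrict) auto
  have V [measurable]: "?V \<in> Q x \<rightarrow>\<^sub>M ?E"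
    using ind by (rule indep_var_rv1)
  have W [measurable]: "(\<lambda>\<omega>. \<lambda>k\<in>{..n}. T k \<omega>) \<in> Q x \<rightarrow>\<^sub>M ?E"
    using measurable_compose[OF V \<Phi>] by (rule measurable_cong[THEN iffD2, rotated]) (simp add: W_eq space_Q)
  have \<xi>S [measurable]: "\<xi> (Suc n) \<in> Q x \<rightarrow>\<^sub>M nonneg_borel"
    using \<xi>[of "Suc n"] by simp
  show ?thesis
  proof (rule integral_disintegration[OF Q W \<xi>S _ _ \<phi> bd])
    show "(\<lambda>_. G) \<in> Q x \<rightarrow>\<^sub>M prob_algebra nonneg_borel"
      using G by simp
    fix B A assume B [measurable]: "B \<in> sets ?E" and A [measurable]: "A \<in> sets nonneg_borel"
    let ?B = "\<Phi> -` B \<inter> space ?E" and ?A = "(\<lambda>w. w (Suc n)) -` A \<inter> space ?E'"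
    have "prob {\<omega> \<in> space (Q x). (\<lambda>k\<in>{..n}. T k \<omega>) \<in> B \<and> \<xi> (Suc n) \<omega> \<in> A}
      = prob ((\<lambda>\<omega>. (?V \<omega>, ?V' \<omega>)) -` (?B \<times> ?A) \<inter> space (Q x))"
      using W_eq measurable_space[OF V] measurable_space[OF indep_var_rv2[OF ind]]
      by (intro arg_cong[where f=prob]) (auto simp: space_Q Z_def)
    also have "\<dots> = prob (?V -` ?B \<inter> space (Q x)) * prob (?V' -` ?A \<inter> space (Q x))"
    proof (rule indep_varD[OF ind])
      show "?A \<in> sets ?E'"
        by (rule measurable_sets[OF _ A]) simp
    qed (use measurable_sets[OF \<Phi> B] in simp)
    also have "?V' -` ?A \<inter> space (Q x) = \<xi> (Suc n) -` A \<inter> space (Q x)"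
      using measurable_space[OF indep_var_rv2[OF ind]] by (auto simp: Z_def)
    also have "prob \<dots> = measure G A"
      using \<xi>_distr[of "Suc n"] measure_distr[OF \<xi>S A] by simp
    also have "?V -` ?B \<inter> space (Q x) = {\<omega> \<in> space (Q x). (\<lambda>k\<in>{..n}. T k \<omega>) \<in> B}"
      using W_eq measurable_space[OF V] by (auto simp: space_Q)
    also have "prob \<dots> = (\<integral>\<omega>. indicator B (\<lambda>k\<in>{..n}. T k \<omega>) \<partial>Q x)"
      by (subst Bochner_Integration.integral_cong[OF refl, of _ _ "indicator {\<omega> \<in> space (Q x). (\<lambda>k\<in>{..n}. T k \<omega>) \<in> B}"])
         (auto simp: indicator_def Int_absorb2 subset_iff)
    finally show "prob {\<omega> \<in> space (Q x). (\<lambda>k\<in>{..n}. T k \<omega>) \<in> B \<and> \<xi> (Suc n) \<omega> \<in> A}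
      = (\<integral>\<omega>. indicator B (\<lambda>k\<in>{..n}. T k \<omega>) * measure G A \<partial>Q x)"
      by (simp only: integral_mult_left_zero)
  qed
qed

text \<open>Pushing \<open>L x\<close> forward under \<open>Pair x\<close> moves the parameter of
  the integrand into the measure. What is left is the integral of one fixed function against a
  measurable kernel.\<close>

lemma borel_measurable_integral_kernel:
  fixes f :: "'b \<Rightarrow> 'c \<Rightarrow> real"
  assumes f: "(\<lambda>(x, z). f x z) \<in> borel_measurable (E \<Otimes>\<^sub>M N)" and L [measurable]: "L \<in> E \<rightarrow>\<^sub>M prob_algebra N"
  shows "(\<lambda>x. \<integral>z. f x z \<partial>L x) \<in> borel_measurable E"
proof -
  have "(\<lambda>x. distr (L x) (E \<Otimes>\<^sub>M N) (Pair x)) \<in> E \<rightarrow>\<^sub>M prob_algebra (E \<Otimes>\<^sub>M N)"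
    by measurable
  then have "(\<lambda>x. \<integral>p. (\<lambda>(x, z). f x z) p \<partial>distr (L x) (E \<Otimes>\<^sub>M N) (Pair x)) \<in> borel_measurable E"
    by (rule measurable_compose[OF measurable_prob_algebraD]) (rule integral_measurable_subprob_algebra[OF f])
  moreover have "(\<integral>p. (\<lambda>(x, z). f x z) p \<partial>distr (L x) (E \<Otimes>\<^sub>M N) (Pair x)) = (\<integral>z. f x z \<partial>L x)"
    if x: "x \<in> space E" for x
  proof -
    have "sets (L x) = sets N"
      using measurable_space[OF L x] by (simp add: space_prob_algebra)
    then have "Pair x \<in> L x \<rightarrow>\<^sub>M E \<Otimes>\<^sub>M N"
      using x by (simp add: measurable_Pair1' cong: measurable_cong_sets)
    then show ?thesis by (subst integral_distr[OF _ f]) auto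
  qed
  ultimately show ?thesis
    by (rule measurable_cong[THEN iffD1, rotated]) 
qed

section \<open>Convergence of one killed step\<close>

text \<open>Nothing is known about \<open>K(t z, \<cdot>)\<close> when \<open>z\<close> tends to \<open>0\<close> through positive values, so a limit \<open>0\<close>
  is only admitted for sequences that reach it, as the extremal component does when it is killed.\<close>

definition absorbed_lim :: "(nat \<Rightarrow> real) \<Rightarrow> real \<Rightarrow> bool" where
  "absorbed_lim a l \<longleftrightarrow>
     (\<forall>n. 0 \<le> a n) \<and> a \<longlonglongrightarrow> l \<and> (l = 0 \<longrightarrow> (\<forall>\<^sub>F n in sequentially. a n = 0))"

lemma absorbed_lim_nonneg: "absorbed_lim a l \<Longrightarrow> 0 \<le> l"
  by (auto simp: absorbed_lim_def intro: LIMSEQ_le_const)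

lemma absorbed_lim_const: "0 \<le> l \<Longrightarrow> absorbed_lim (\<lambda>_. l) l"
  by (simp add: absorbed_lim_def)

text \<open>Here \<open>a\<close> and the result are measured in units of \<open>t\<close>, whereas the unkilled next state \<open>x\<close> and the
  boundary \<open>c = t y(t)\<close> are not.\<close>

definition next_state :: "real \<Rightarrow> real \<Rightarrow> real \<Rightarrow> real \<Rightarrow> real" where
  "next_state t c a x = (if a = 0 \<or> x \<le> c then 0 else x / t)"

text \<open>A function \<open>cts_step p q\<close> vanishes above \<open>q\<close>, so on the
  half-line it extends continuously to \<open>[0,\<infinity>]\<close> and may be used as a test
  function there. Since such functions determine weak convergence on the real line, this transfers
  the domain of attraction to the setting in which Skorohod's theorem is available.\<close>

lemma domain_of_attraction_cts_step:
  assumes "in_domain_of_attraction K G"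
    and K: "K \<in> nonneg_borel \<rightarrow>\<^sub>M prob_algebra nonneg_borel"
    and G: "G \<in> space (prob_algebra nonneg_borel)"
    and s: "filterlim s at_top sequentially" "\<And>n. 0 < s n" and pq: "p < q"
  shows "(\<lambda>n. \<integral>x. cts_step p q (x / s n) \<partial>K (s n)) \<longlonglongrightarrow> (\<integral>x. cts_step p q x \<partial>G)"
proof -
  \<comment> \<open>Capping at \<open>B\<close> makes the passage from \<open>ennreal\<close> to the
    reals continuous at infinity. It leaves the test function unchanged on the half-line, because
    the step is already \<open>0\<close> from \<open>q\<close> on; the maximum with \<open>0\<close>
    covers negative \<open>q\<close>.\<close>
  define B where "B = max q 0"
  have B: "0 \<le> B" "q \<le> B" by (simp_all add: B_def)
  define \<psi> where "\<psi> e = cts_step p q (enn2real (min e (ennreal B)))" for e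
  have cts: "continuous_on UNIV (cts_step p q)"
    using cts_step_uniformly_continuous[OF pq] by (rule uniformly_continuous_imp_continuous)
  have "continuous_on UNIV (\<lambda>e. enn2real (min e (ennreal B)))"
    unfolding continuous_on_def
  proof safe
    fix e :: ennreal
    have "min e (ennreal B) < top" by (simp add: min_less_iff_disj)
    then obtain r where r: "0 \<le> r" "min e (ennreal B) = ennreal r"
      by (cases "min e (ennreal B)") auto
    have "((\<lambda>e. min e (ennreal B)) \<longlongrightarrow> min e (ennreal B)) (at e)"
      by (intro tendsto_intros)
    then show "((\<lambda>e. enn2real (min e (ennreal B))) \<longlongrightarrow> enn2real (min e (ennreal B))) (at e)"
      using r tendsto_enn2real[of "\<lambda>e. min e (ennreal B)" r "at e"] by simp
  qed
  then have \<psi>_cont: "continuous_on UNIV \<psi>"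
    unfolding \<psi>_def by (rule continuous_on_compose2[OF cts]) auto
  then have \<psi>_meas [measurable]: "\<psi> \<in> borel_measurable borel"
    by (rule borel_measurable_continuous_onI)
  have "bounded (range \<psi>)"
    by (rule boundedI[of _ 1]) (use pq in \<open>auto simp: \<psi>_def cts_step_def\<close>)
  then have "((\<lambda>t. \<integral>e. \<psi> e \<partial>distr (K t) borel (\<lambda>x. ennreal (x / t))) \<longlongrightarrow>
      (\<integral>e. \<psi> e \<partial>distr G borel ennreal)) at_top"
    using assms(1) \<psi>_cont unfolding in_domain_of_attraction_def weak_conv_along_def by simp
  then have lim: "(\<lambda>n. \<integral>e. \<psi> e \<partial>distr (K (s n)) borel (\<lambda>x. ennreal (x / s n))) \<longlonglongrightarrow>
      (\<integral>e. \<psi> e \<partial>distr G borel ennreal)"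
    by (rule filterlim_compose[OF _ s(1)])
  have \<psi>_ennreal: "\<psi> (ennreal x) = cts_step p q x" if "0 \<le> x" for x
  proof -
    have "min (ennreal x) (ennreal B) = ennreal (min x B)"
      using that B by (simp add: min_def)
    then show ?thesis
      using that pq B by (auto simp: \<psi>_def cts_step_def min_def)
  qed
  have "(\<integral>e. \<psi> e \<partial>distr (K (s n)) borel (\<lambda>x. ennreal (x / s n))) = (\<integral>x. cts_step p q (x / s n) \<partial>K (s n))" for n
  proof -
    have [measurable_cong]: "sets (K (s n)) = sets nonneg_borel"
      using measurable_space[OF K, of "s n"] s(2)[of n] by (simp add: space_prob_algebra)
    have "(\<integral>e. \<psi> e \<partial>distr (K (s n)) borel (\<lambda>x. ennreal (x / s n))) = (\<integral>x. \<psi> (ennreal (x / s n)) \<partial>K (s n))"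
    proof (rule integral_distr)
      show "(\<lambda>x. ennreal (x / s n)) \<in> borel_measurable (K (s n))"
        unfolding measurable_cong_sets[OF \<open>sets (K (s n)) = _\<close> refl] by (rule measurable_restrict_space1) simp
    qed (rule \<psi>_meas)
    also have "\<dots> = (\<integral>x. cts_step p q (x / s n) \<partial>K (s n))"
      using s(2)[of n] sets_eq_imp_space_eq[OF \<open>sets (K (s n)) = _\<close>]
      by (intro Bochner_Integration.integral_cong refl \<psi>_ennreal) auto
    finally show ?thesis .
  qed
  moreover have "(\<integral>e. \<psi> e \<partial>distr G borel ennreal) = (\<integral>x. cts_step p q x \<partial>G)"
  proof -
    have [measurable_cong]: "sets G = sets nonneg_borel"
      using G by (simp add: space_prob_algebra)
    have "(\<integral>e. \<psi> e \<partial>distr G borel ennreal) = (\<integral>x. \<psi> (ennreal x) \<partial>G)"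
    proof (rule integral_distr)
      show "ennreal \<in> borel_measurable G"
        unfolding measurable_cong_sets[OF \<open>sets G = _\<close> refl] by (rule measurable_restrict_space1) simp
    qed (rule \<psi>_meas)
    also have "\<dots> = (\<integral>x. cts_step p q x \<partial>G)"
      using sets_eq_imp_space_eq[OF \<open>sets G = _\<close>]
      by (intro Bochner_Integration.integral_cong refl \<psi>_ennreal) auto
    finally show ?thesis .
  qed
  ultimately show ?thesis using lim by simp
qed

text \<open>Uniformity of the boundary quantifies over functions of a real variable. A sequence of
  starting points is turned into such a function by placing \<open>a n\<close> at \<open>t n\<close>
  and the limit \<open>l\<close> everywhere else; strict monotonicity of \<open>t\<close> makes this
  well defined and lets it converge to \<open>l\<close>.\<close>

lemma uniform_boundary_sequentially:
  assumes ub: "uniform_extremal_boundary K G y"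
    and t: "strict_mono t"
    and a: "\<And>n. 0 \<le> a n" "a \<longlonglongrightarrow> l" and l: "0 < l" and top: "filterlim t at_top sequentially"
  shows "(\<lambda>n. measure (K (t n * a n)) ((*) (t n) ` {0..y (t n)})) \<longlonglongrightarrow> measure G {0}"
proof -
  define u where "u r = (if r \<in> range t then a (inv t r) else l)" for r
  have inj: "inj t" using t by (rule strict_mono_imp_inj_on)
  have u_t: "u (t n) = a n" for n
    using inj by (simp add: u_def)
  have "(u \<longlongrightarrow> l) at_top"
  proof (rule tendstoI)
    fix e :: real assume e: "0 < e"
    obtain N where N: "\<And>n. n \<ge> N \<Longrightarrow> dist (a n) l < e"
      using tendstoD[OF a(2) e] by (auto simp: eventually_sequentially)
    have "dist (u r) l < e" if r: "t N \<le> r" for r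
    proof (cases "r \<in> range t")
      case True
      then obtain n where n: "r = t n" by auto
      then have "N \<le> n" using r t by (simp add: strict_mono_less_eq)
      then show ?thesis using N n u_t by simp
    qed (simp add: u_def e)
    then show "\<forall>\<^sub>F r in at_top. dist (u r) l < e"
      by (auto simp: eventually_at_top_linorder)
  qed
  moreover have "\<forall>r\<ge>0. 0 \<le> u r"
    using a(1) l by (auto simp: u_def)
  ultimately have "((\<lambda>r. measure (K (r * u r)) ((*) r ` {0..y r})) \<longlongrightarrow> measure G {0}) at_top"
    using ub l unfolding uniform_extremal_boundary_def by blast
  then have "(\<lambda>n. measure (K (t n * u (t n))) ((*) (t n) ` {0..y (t n)})) \<longlonglongrightarrow> measure G {0}"
    by (rule filterlim_compose[OF _ top])
  then show ?thesis by (simp add: u_t)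
qed

text \<open>With all starting points positive, the step can be described by the ratio of successive
  states, and these ratios can be coupled to converge pointwise. The integrands then converge
  wherever the limit ratio is positive; near the limit \<open>0\<close> only the probability of not
  yet being killed has to be controlled.\<close>

lemma killed_step_tendsto_pos:
  fixes h :: "nat \<Rightarrow> real \<Rightarrow> real"
  assumes K: "K \<in> nonneg_borel \<rightarrow>\<^sub>M prob_algebra nonneg_borel"
    and G: "G \<in> space (prob_algebra nonneg_borel)"
    and doa: "in_domain_of_attraction K G" and ub: "uniform_extremal_boundary K G y"
    and t: "strict_mono t" "filterlim t at_top sequentially" "\<And>n. 0 < t n"
    and a: "\<And>n. 0 < a n" "a \<longlonglongrightarrow> l" and l: "0 < l"
    and h: "\<And>n. h n \<in> borel_measurable nonneg_borel" and H: "H \<in> borel_measurable nonneg_borel"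
    and bd: "\<And>n x. \<bar>h n x\<bar> \<le> C" "\<And>x. \<bar>H x\<bar> \<le> C"
    and conv: "\<And>z \<zeta>. absorbed_lim z \<zeta> \<Longrightarrow> (\<lambda>n. h n (z n)) \<longlonglongrightarrow> H \<zeta>"
  shows "(\<lambda>n. \<integral>x. h n (next_state (t n) (t n * y (t n)) (a n) x) \<partial>K (t n * a n)) \<longlonglongrightarrow> (\<integral>x. H (l * x) \<partial>G)"
proof -
  \<comment> \<open>\<open>s n\<close> is the present state before scaling, so
    \<open>x / s n\<close> is the ratio of the next state to the present one. Its law tends to
    \<open>G\<close> because \<open>s n\<close> tends to infinity.\<close>
  define s where "s n = t n * a n" for n
  define b where "b n = y (t n)" for n
  have s_pos: "0 < s n" for n using t(3) a(1) by (simp add: s_def)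
  have s_top: "filterlim s at_top sequentially"
    unfolding s_def using filterlim_at_top_mult_tendsto_pos[OF a(2) l t(2)] by (simp add: mult.commute)
  have b_nonneg: "0 \<le> b n" for n
    using ub t(3)[of n] by (auto simp: b_def uniform_extremal_boundary_def extremal_boundary_def)
  have b_lim: "b \<longlonglongrightarrow> 0"
    unfolding b_def using ub t(2)
    by (auto simp: uniform_extremal_boundary_def extremal_boundary_def intro: filterlim_compose)
  have sets_K: "sets (K (s n)) = sets nonneg_borel" and prob_K: "prob_space (K (s n))" for n
    using measurable_space[OF K, of "s n"] s_pos[of n] by (simp_all add: space_prob_algebra)
  note [measurable_cong] = sets_K
  have space_K: "space (K (s n)) = {0..}" for n
    using sets_eq_imp_space_eq[OF sets_K] by simp
  have sets_G [measurable_cong]: "sets G = sets nonneg_borel" and prob_G: "prob_space G"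
    using G by (auto simp: space_prob_algebra)
  have space_G: "space G = {0..}"
    using sets_eq_imp_space_eq[OF sets_G] by simp
  have div_K [measurable]: "(\<lambda>x. x / s n) \<in> borel_measurable (K (s n))" for n
    unfolding measurable_cong_sets[OF sets_K refl] by (rule measurable_restrict_space1) simp
  have id_G [measurable]: "(\<lambda>x. x) \<in> borel_measurable G"
    unfolding measurable_cong_sets[OF sets_G refl] by (rule measurable_restrict_space1) simp

  \<comment> \<open>Coupling of the laws of the ratios\<close>
  define \<mu> where "\<mu> n = distr (K (s n)) borel (\<lambda>x. x / s n)" for n
  define M where "M = distr G borel (\<lambda>x. x)"
  have \<mu>: "real_distribution (\<mu> n)" for n
    unfolding \<mu>_def by (intro prob_space.real_distribution_distr prob_K div_K)
  have M: "real_distribution M"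
    unfolding M_def by (intro prob_space.real_distribution_distr prob_G id_G)
  have [measurable]: "cts_step p q \<in> borel_measurable borel" if "p < q" for p q
    using cts_step_uniformly_continuous[OF that]
    by (intro borel_measurable_continuous_onI uniformly_continuous_imp_continuous)
  have "weak_conv_m \<mu> M"
  proof (rule integral_cts_step_conv_imp_weak_conv[OF \<mu> M])
    fix p q :: real assume pq: "p < q"
    show "(\<lambda>n. integral\<^sup>L (\<mu> n) (cts_step p q)) \<longlonglongrightarrow> integral\<^sup>L M (cts_step p q)"
      using domain_of_attraction_cts_step[OF doa K G s_top s_pos pq] pq
      by (simp add: \<mu>_def M_def integral_distr)
  qed
  from Skorohod[OF \<mu> M this] obtain \<Omega> :: "real measure" and Y Y0
    where \<Omega>: "prob_space \<Omega>" and Y [measurable]: "\<And>n. Y n \<in> borel_measurable \<Omega>"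
      and Y_distr: "\<And>n. distr \<Omega> borel (Y n) = \<mu> n" and "Y0 \<in> \<Omega> \<rightarrow>\<^sub>M lborel"
      and Y0_distr: "distr \<Omega> borel Y0 = M" and Y_lim: "\<And>\<omega>. \<omega> \<in> space \<Omega> \<Longrightarrow> (\<lambda>n. Y n \<omega>) \<longlonglongrightarrow> Y0 \<omega>"
    by metis
  then have Y0 [measurable]: "Y0 \<in> borel_measurable \<Omega>" by simp
  interpret prob_space \<Omega> by fact
  \<comment> \<open>Skorohod's variables are only almost surely nonnegative, hence the \<open>max 0\<close>.\<close>
  define q where "q n r = (if a n * max 0 r \<le> b n then 0 else a n * max 0 r)" for n r
  define Z where "Z n \<omega> = q n (Y n \<omega>)" for n \<omega>
  define W where "W \<omega> = max 0 (Y0 \<omega>)" for \<omega>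
  have q_nonneg: "0 \<le> q n r" for n r
    using a(1)[of n] by (simp add: q_def)
  have q_meas [measurable]: "q n \<in> borel \<rightarrow>\<^sub>M nonneg_borel" for n
    by (rule measurable_restrict_space2) (auto simp: q_nonneg, simp add: q_def[abs_def])
  \<comment> \<open>Multiplying the ratio by \<open>a n\<close> gives the next state in units of
    \<open>t n\<close>, so \<open>q n\<close> is the killed transition in the coordinates of the
    coupling.\<close>
  have q_K: "q n (x / s n) = next_state (t n) (t n * b n) (a n) x" if "0 \<le> x" for n x
  proof -
    have "a n * max 0 (x / s n) = x / t n"
      using that a(1)[of n] t(3)[of n] by (simp add: s_def max_def divide_simps)
    moreover have "x / t n \<le> b n \<longleftrightarrow> x \<le> t n * b n"
      using t(3)[of n] by (simp add: field_simps)
    ultimately show ?thesis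
      using a(1)[of n] by (simp add: q_def next_state_def)
  qed

  \<comment> \<open>Laws of the coupled variables\<close>
  note [measurable] = h H
  have law_Z: "(\<integral>\<omega>. g (q n (Y n \<omega>)) \<partial>\<Omega>) = (\<integral>x. g (next_state (t n) (t n * b n) (a n) x) \<partial>K (s n))"
    if g: "g \<in> borel_measurable nonneg_borel" for n and g :: "real \<Rightarrow> real"
  proof -
    have gq [measurable]: "(\<lambda>r. g (q n r)) \<in> borel_measurable borel"
      by (rule measurable_compose[OF q_meas g])
    have "(\<integral>\<omega>. g (q n (Y n \<omega>)) \<partial>\<Omega>) = (\<integral>r. g (q n r) \<partial>\<mu> n)"
      unfolding Y_distr[symmetric] by (rule integral_distr[symmetric]) measurable
    also have "\<dots> = (\<integral>x. g (q n (x / s n)) \<partial>K (s n))"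
      unfolding \<mu>_def by (rule integral_distr) measurable
    also have "\<dots> = (\<integral>x. g (next_state (t n) (t n * b n) (a n) x) \<partial>K (s n))"
      by (intro Bochner_Integration.integral_cong refl) (simp add: space_K q_K)
    finally show ?thesis .
  qed
  have law_W: "(\<integral>\<omega>. g (W \<omega>) \<partial>\<Omega>) = (\<integral>x. g x \<partial>G)"
    if g: "g \<in> borel_measurable nonneg_borel" for g :: "real \<Rightarrow> real"
  proof -
    have [measurable]: "(\<lambda>r. g (max 0 r)) \<in> borel_measurable borel"
      by (rule measurable_compose[OF _ g]) (auto intro!: measurable_restrict_space2)
    have "(\<integral>\<omega>. g (W \<omega>) \<partial>\<Omega>) = (\<integral>r. g (max 0 r) \<partial>M)"
      unfolding Y0_distr[symmetric] W_def by (rule integral_distr[symmetric]) measurable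
    also have "\<dots> = (\<integral>x. g (max 0 x) \<partial>G)"
      unfolding M_def by (rule integral_distr) measurable
    also have "\<dots> = (\<integral>x. g x \<partial>G)"
      by (intro Bochner_Integration.integral_cong refl) (simp add: space_G)
    finally show ?thesis .
  qed
  have W_meas [measurable]: "W \<in> \<Omega> \<rightarrow>\<^sub>M nonneg_borel"
    unfolding W_def by (auto intro!: measurable_restrict_space2)
  have Z_meas [measurable]: "Z n \<in> \<Omega> \<rightarrow>\<^sub>M nonneg_borel" for n
    unfolding Z_def by measurable
  have W_real [measurable]: "W \<in> borel_measurable \<Omega>" and Z_real [measurable]: "Z n \<in> borel_measurable \<Omega>" for n
    using W_meas Z_meas[of n] by (auto simp: measurable_restrict_space2_iff)
  have lW [measurable]: "(\<lambda>\<omega>. H (l * W \<omega>)) \<in> borel_measurable \<Omega>"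
    by (rule measurable_compose[OF _ H]) (use l in \<open>auto intro!: measurable_restrict_space2 simp: W_def\<close>)
  have hZ [measurable]: "(\<lambda>\<omega>. h n (Z n \<omega>)) \<in> borel_measurable \<Omega>" for n
    by (rule measurable_compose[OF Z_meas h])

  \<comment> \<open>Mass of the killed state at zero\<close>
  define p where "p n = (\<integral>\<omega>. indicat_real {0} (W \<omega>) \<partial>\<Omega>) - (\<integral>\<omega>. indicat_real {0} (Z n \<omega>) \<partial>\<Omega>)" for n
  have ind_meas: "indicat_real {0} \<in> borel_measurable nonneg_borel"
    by (rule measurable_restrict_space1) simp
  have p_lim: "p \<longlonglongrightarrow> 0"
  proof -
    \<comment> \<open>Since \<open>a n\<close> is positive and the boundary nonnegative, the killed
      state is \<open>0\<close> exactly when the unkilled one is at most \<open>t n * b n\<close>.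
      This is the event in the definition of the uniform extremal boundary.\<close>
    have "(\<integral>\<omega>. indicat_real {0} (Z n \<omega>) \<partial>\<Omega>) = measure (K (t n * a n)) ((*) (t n) ` {0..y (t n)})" for n
    proof -
      have "(\<integral>\<omega>. indicat_real {0} (Z n \<omega>) \<partial>\<Omega>)
          = (\<integral>x. indicat_real {0} (next_state (t n) (t n * b n) (a n) x) \<partial>K (s n))"
        unfolding Z_def by (rule law_Z[OF ind_meas])
      also have "\<dots> = (\<integral>x. indicat_real {0..t n * b n} x \<partial>K (s n))"
        using a(1)[of n] t(3)[of n] b_nonneg[of n]
        by (intro Bochner_Integration.integral_cong refl)
           (auto simp: space_K next_state_def indicator_def zero_le_mult_iff)
      also have "\<dots> = measure (K (s n)) {0..t n * b n}"
        by (simp add: space_K Int_absorb2 subset_iff)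
      finally show ?thesis
        using t(3)[of n] b_nonneg[of n] by (simp add: s_def b_def image_mult_atLeastAtMost)
    qed
    moreover have "(\<integral>\<omega>. indicat_real {0} (W \<omega>) \<partial>\<Omega>) = measure G {0}"
      by (subst law_W[OF ind_meas]) (simp add: space_G)
    ultimately show ?thesis
      unfolding p_def
      using uniform_boundary_sequentially[OF ub t(1) _ a(2) l t(2)] a(1)
      by (auto intro!: tendsto_eq_intros simp: less_imp_le)
  qed

  \<comment> \<open>Pointwise bound for the coupling error\<close>
  define D where "D n \<omega> = h n (Z n \<omega>) - H (l * W \<omega>)" for n \<omega>
  \<comment> \<open>On \<open>W = 0\<close> the hypothesis on \<open>h\<close> says nothing about \<open>Z n\<close> as long as \<open>Z n \<noteq> 0\<close>. The probability of
    this event is \<open>p n + P(W \<noteq> 0, Z n = 0)\<close>, where \<open>p\<close> vanishes by the uniformity of the boundary and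
    the second summand is absorbed into \<open>F\<close>.\<close>
  define F where "F n \<omega> = (if W \<omega> = 0 then 0 else \<bar>D n \<omega>\<bar>) + \<bar>h n 0 - H 0\<bar> +
    2 * C * (if W \<omega> \<noteq> 0 \<and> Z n \<omega> = 0 then 1 else 0)" for n \<omega>
  have D_meas [measurable]: "D n \<in> borel_measurable \<Omega>" for n
    unfolding D_def by measurable
  have F_meas [measurable]: "F n \<in> borel_measurable \<Omega>" for n
    unfolding F_def by measurable
  have C: "0 \<le> C" using bd(2)[of 0] by simp
  have D_bd: "\<bar>D n \<omega>\<bar> \<le> 2 * C" for n \<omega>
    using bd(1)[of n "Z n \<omega>"] bd(2)[of "l * W \<omega>"] unfolding D_def by linarith
  \<comment> \<open>Each of the three summands of \<open>F\<close> is at most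
    \<open>2 * C\<close>.\<close>
  have F_bd: "\<bar>F n \<omega>\<bar> \<le> 6 * C" for n \<omega>
    using D_bd[of n \<omega>] bd(1)[of n 0] bd(2)[of 0] C unfolding F_def by (auto simp: abs_le_iff)
  \<comment> \<open>If \<open>W\<close> and \<open>Z n\<close> both vanish, the error is
    \<open>h n 0 - H 0\<close>. If only \<open>W\<close> vanishes, the difference of indicators is
    \<open>1\<close> and \<open>2 * C\<close> covers the error. If only \<open>Z n\<close> vanishes,
    that difference is \<open>-1\<close> and is cancelled by the last summand of \<open>F\<close>.
    If neither does, the error itself is a summand of \<open>F\<close>.\<close>
  have F_nn: "\<bar>D n \<omega>\<bar> \<le> F n \<omega> + 2 * C * (indicat_real {0} (W \<omega>) - indicat_real {0} (Z n \<omega>))" for n \<omega>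
    using D_bd[of n \<omega>] C unfolding F_def by (cases "Z n \<omega> = 0") (auto simp: D_def)
  have F_lim: "(\<lambda>n. F n \<omega>) \<longlonglongrightarrow> 0" if \<omega>: "\<omega> \<in> space \<Omega>" for \<omega>
  proof -
    have h0: "(\<lambda>n. \<bar>h n 0 - H 0\<bar>) \<longlonglongrightarrow> 0"
      using conv[OF absorbed_lim_const[of 0]] by (intro tendsto_rabs_zero) (auto simp: LIM_zero_iff)
    show ?thesis
    proof (cases "W \<omega> = 0")
      case True
      then show ?thesis using h0 by (simp add: F_def)
    next
      case False
      then have Wpos: "0 < W \<omega>" by (auto simp: W_def)
      have lim: "(\<lambda>n. a n * max 0 (Y n \<omega>)) \<longlonglongrightarrow> l * W \<omega>"
        unfolding W_def by (intro tendsto_intros a(2) Y_lim[OF \<omega>])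
      \<comment> \<open>The unkilled state has the positive limit \<open>l * W \<omega>\<close>,
        while the boundary tends to \<open>0\<close>, so no killing occurs from some index
        on.\<close>
      have "\<forall>\<^sub>F n in sequentially. b n < a n * max 0 (Y n \<omega>)"
        using order_tendstoD(1)[OF tendsto_diff[OF lim b_lim], of 0] Wpos l by simp
      then have ev: "\<forall>\<^sub>F n in sequentially. Z n \<omega> = a n * max 0 (Y n \<omega>) \<and> Z n \<omega> > 0"
        by eventually_elim (use b_nonneg in \<open>auto simp: Z_def q_def intro: le_less_trans\<close>)
      then have ev0: "\<forall>\<^sub>F n in sequentially. Z n \<omega> \<noteq> 0"
        by (rule eventually_mono) auto
      have "(\<lambda>n. Z n \<omega>) \<longlonglongrightarrow> l * W \<omega>"
        using lim by (rule Lim_transform_eventually) (use ev in eventually_elim, simp)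
      then have "absorbed_lim (\<lambda>n. Z n \<omega>) (l * W \<omega>)"
        using Wpos l q_nonneg by (simp add: absorbed_lim_def Z_def)
      then have "(\<lambda>n. D n \<omega>) \<longlonglongrightarrow> 0"
        unfolding D_def using conv by (auto simp: LIM_zero_iff)
      then have "(\<lambda>n. \<bar>D n \<omega>\<bar> + \<bar>h n 0 - H 0\<bar>) \<longlonglongrightarrow> 0"
        using tendsto_add[OF tendsto_rabs_zero h0] by simp
      then show ?thesis
        by (rule Lim_transform_eventually) (use ev0 in eventually_elim, simp add: F_def False)
    qed
  qed

  \<comment> \<open>Passage to the limit under the integral\<close>
  have int_bdd: "integrable \<Omega> f" if "f \<in> borel_measurable \<Omega>" "\<And>\<omega>. \<bar>f \<omega>\<bar> \<le> c" for f :: "real \<Rightarrow> real" and c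
    using that by (intro integrable_const_bound[where B=c]) auto
  have F_int: "(\<lambda>n. \<integral>\<omega>. F n \<omega> \<partial>\<Omega>) \<longlonglongrightarrow> (\<integral>\<omega>. 0 \<partial>\<Omega>)"
    by (rule integral_dominated_convergence[where w="\<lambda>_. 6 * C"]) (use F_lim F_bd in auto)
  have D_le: "\<bar>\<integral>\<omega>. D n \<omega> \<partial>\<Omega>\<bar> \<le> (\<integral>\<omega>. F n \<omega> \<partial>\<Omega>) + 2 * C * p n" for n
  proof -
    have iW: "integrable \<Omega> (\<lambda>\<omega>. indicat_real {0} (W \<omega>))"
      by (rule int_bdd[of _ 1]) (auto simp: indicator_def)
    have iZ: "integrable \<Omega> (\<lambda>\<omega>. indicat_real {0} (Z n \<omega>))"
      by (rule int_bdd[of _ 1]) (auto simp: indicator_def)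
    have iF: "integrable \<Omega> (F n)"
      by (rule int_bdd[OF F_meas F_bd])
    have "\<bar>\<integral>\<omega>. D n \<omega> \<partial>\<Omega>\<bar> \<le> (\<integral>\<omega>. \<bar>D n \<omega>\<bar> \<partial>\<Omega>)"
      by (rule integral_abs_bound)
    also have "\<dots> \<le> (\<integral>\<omega>. F n \<omega> + 2 * C * (indicat_real {0} (W \<omega>) - indicat_real {0} (Z n \<omega>)) \<partial>\<Omega>)"
    proof (rule integral_mono)
      show "integrable \<Omega> (\<lambda>\<omega>. \<bar>D n \<omega>\<bar>)"
        by (rule int_bdd[of _ "2 * C"]) (use D_bd in auto)
      show "integrable \<Omega> (\<lambda>\<omega>. F n \<omega> + 2 * C * (indicat_real {0} (W \<omega>) - indicat_real {0} (Z n \<omega>)))"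
        using iW iZ iF by simp
    qed (rule F_nn)
    also have "\<dots> = (\<integral>\<omega>. F n \<omega> \<partial>\<Omega>) + 2 * C * p n"
      using iW iZ iF by (simp add: p_def)
    finally show ?thesis .
  qed
  have "(\<lambda>n. \<integral>\<omega>. D n \<omega> \<partial>\<Omega>) \<longlonglongrightarrow> 0"
  proof (rule Lim_null_comparison)
    show "(\<lambda>n. (\<integral>\<omega>. F n \<omega> \<partial>\<Omega>) + 2 * C * p n) \<longlonglongrightarrow> 0"
      using F_int p_lim by (auto intro!: tendsto_eq_intros)
  qed (simp add: D_le)
  moreover have "(\<integral>\<omega>. D n \<omega> \<partial>\<Omega>) =
      (\<integral>x. h n (next_state (t n) (t n * y (t n)) (a n) x) \<partial>K (t n * a n)) - (\<integral>x. H (l * x) \<partial>G)" for n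
  proof -
    have "(\<lambda>x. H (l * x)) \<in> borel_measurable nonneg_borel"
      by (rule measurable_compose[OF _ H]) (use l in \<open>auto intro!: measurable_nonneg_borel_times\<close>)
    then show ?thesis
      unfolding D_def using bd
      by (simp add: Bochner_Integration.integral_diff int_bdd[of _ C] law_W[of "\<lambda>x. H (l * x)"]
          law_Z[OF h, folded Z_def, unfolded s_def b_def])
  qed
  ultimately show ?thesis
    by (simp add: LIM_zero_iff)
qed

text \<open>A zero limit means that the starting points are eventually \<open>0\<close>. This state
  is absorbing, so the integral reduces to \<open>h n 0\<close>, which converges to
  \<open>H 0\<close>. A positive limit reduces to strictly positive starting points by changing
  finitely many terms.\<close>

lemma killed_step_tendsto:
  fixes h :: "nat \<Rightarrow> real \<Rightarrow> real"
  assumes K: "K \<in> nonneg_borel \<rightarrow>\<^sub>M prob_algebra nonneg_borel"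
    and G: "G \<in> space (prob_algebra nonneg_borel)"
    and doa: "in_domain_of_attraction K G" and ub: "uniform_extremal_boundary K G y"
    and t: "strict_mono t" "filterlim t at_top sequentially" "\<And>n. 0 < t n"
    and a: "absorbed_lim a l"
    and h: "\<And>n. h n \<in> borel_measurable nonneg_borel" and H: "H \<in> borel_measurable nonneg_borel"
    and bd: "\<And>n x. \<bar>h n x\<bar> \<le> C" "\<And>x. \<bar>H x\<bar> \<le> C"
    and conv: "\<And>z \<zeta>. absorbed_lim z \<zeta> \<Longrightarrow> (\<lambda>n. h n (z n)) \<longlonglongrightarrow> H \<zeta>"
  shows "(\<lambda>n. \<integral>x. h n (next_state (t n) (t n * y (t n)) (a n) x) \<partial>K (t n * a n)) \<longlonglongrightarrow> (\<integral>x. H (l * x) \<partial>G)"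
proof (cases "l = 0")
  case True
  interpret G: prob_space G using G by (simp add: space_prob_algebra)
  have K_prob: "prob_space (K (t n * a n))" for n
    using measurable_space[OF K, of "t n * a n"] a t(3)[of n]
    by (simp add: space_prob_algebra absorbed_lim_def)
  have "(\<lambda>n. h n 0) \<longlonglongrightarrow> H 0"
    by (rule conv[OF absorbed_lim_const]) simp
  then have "(\<lambda>n. h n 0) \<longlonglongrightarrow> (\<integral>x. H (l * x) \<partial>G)"
    by (simp add: True G.prob_space)
  moreover have "\<forall>\<^sub>F n in sequentially. a n = 0"
    using a True by (simp add: absorbed_lim_def)
  then have "\<forall>\<^sub>F n in sequentially. h n 0 =
      (\<integral>x. h n (next_state (t n) (t n * y (t n)) (a n) x) \<partial>K (t n * a n))"
  proof eventually_elim
    case (elim n)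
    interpret k: prob_space "K (t n * a n)" by (rule K_prob)
    show ?case using elim k.prob_space by (simp add: next_state_def)
  qed
  ultimately show ?thesis by (rule Lim_transform_eventually)
next
  case False
  then have l: "0 < l" using absorbed_lim_nonneg[OF a] by simp
  have a_lim: "a \<longlonglongrightarrow> l" using a by (simp add: absorbed_lim_def)
  \<comment> \<open>The coupling divides by the starting point at every index, so the finitely many
    zeros are replaced by the positive number \<open>l\<close>.\<close>
  define a' where "a' n = (if 0 < a n then a n else l)" for n
  have a'_pos: "0 < a' n" for n
    using l by (simp add: a'_def)
  have ev: "\<forall>\<^sub>F n in sequentially. a' n = a n"
    using order_tendstoD(1)[OF a_lim l] by eventually_elim (simp add: a'_def)
  have "a' \<longlonglongrightarrow> l"
    using a_lim by (rule Lim_transform_eventually) (use ev in eventually_elim, simp)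
  then have "(\<lambda>n. \<integral>x. h n (next_state (t n) (t n * y (t n)) (a' n) x) \<partial>K (t n * a' n)) \<longlonglongrightarrow> (\<integral>x. H (l * x) \<partial>G)"
    using l by (intro killed_step_tendsto_pos[OF K G doa ub t _ _ l h H bd conv]) (use l in \<open>simp_all add: a'_pos\<close>)
  then show ?thesis
    by (rule Lim_transform_eventually) (use ev in eventually_elim, simp)
qed

section \<open>The killed path\<close>

text \<open>An index lies before the infimum of the crossing indices precisely when no crossing has
  occurred up to and including it. This removes the extended naturals from all later
  arguments.\<close>

lemma extremal_component_eq:
  "extremal_component y t x n = (if \<forall>j\<le>n. t * y t < x j then x n else 0)"
proof -
  have "enat n < crossing_time y t x \<longleftrightarrow> (\<forall>j\<le>n. t * y t < x j)"
  proof safe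
    fix j assume "enat n < crossing_time y t x" "j \<le> n"
    then have "enat j < Inf {enat n |n. x n \<le> t * y t}"
      unfolding crossing_time_def by (meson enat_ord_simps(1) le_less_trans)
    then show "t * y t < x j"
      by (metis (mono_tags, lifting) Inf_lower leD linorder_not_le mem_Collect_eq)
  next
    assume *: "\<forall>j\<le>n. t * y t < x j"
    \<comment> \<open>For extended naturals, being above \<open>n\<close> follows from being at
      least \<open>Suc n\<close>, and the latter is a lower bound that can be checked on each
      crossing index.\<close>
    have "enat (Suc n) \<le> crossing_time y t x"
      unfolding crossing_time_def
    proof (rule Inf_greatest)
      fix e assume "e \<in> {enat n |n. x n \<le> t * y t}"
      then obtain k where k: "e = enat k" "x k \<le> t * y t" by auto
      then show "enat (Suc n) \<le> e"
        using * by (metis enat_ord_simps(1) leD not_less_eq_eq)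
    qed
    then show "enat n < crossing_time y t x"
      by (meson enat_ord_simps(2) less_le_trans lessI)
  qed
  then show ?thesis by (auto simp: extremal_component_def)
qed

lemma extremal_component_0: "extremal_component y t x 0 = (if x 0 \<le> t * y t then 0 else x 0)"
  by (auto simp: extremal_component_eq)

text \<open>An uncrossed state exceeds \<open>t * y t\<close> and is therefore positive, as the
  boundary is nonnegative. So the component is \<open>0\<close> at time \<open>n\<close> exactly
  when the boundary has been crossed by then, and its present value alone records whether the path
  has been killed.\<close>

lemma extremal_component_Suc:
  assumes "0 \<le> t * y t" and "0 < t"
  shows "extremal_component y t x (Suc n) / t
    = next_state t (t * y t) (extremal_component y t x n / t) (x (Suc n))"
  using assms by (auto simp: extremal_component_eq next_state_def le_Suc_eq not_less)

lemma extremal_component_cong: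
  "(\<And>j. j \<le> n \<Longrightarrow> x j = x' j) \<Longrightarrow> extremal_component y t x n = extremal_component y t x' n"
  by (auto simp: extremal_component_eq)

lemma measurable_extremal_component:
  assumes "\<And>j. j \<le> n \<Longrightarrow> Y j \<in> M \<rightarrow>\<^sub>M nonneg_borel"
  shows "(\<lambda>\<omega>. extremal_component y t (\<lambda>j. Y j \<omega>) n) \<in> M \<rightarrow>\<^sub>M nonneg_borel"
proof -
  have m: "Y j \<in> borel_measurable M" and nn: "\<And>\<omega>. \<omega> \<in> space M \<Longrightarrow> 0 \<le> Y j \<omega>" if "j \<le> n" for j
    using assms[OF that] by (auto simp: measurable_restrict_space2_iff)
  have "Measurable.pred M (\<lambda>\<omega>. \<forall>j\<in>{..n}. t * y t < Y j \<omega>)"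
    by (intro pred_intros_finite borel_measurable_pred_less m) auto
  then have "Measurable.pred M (\<lambda>\<omega>. \<forall>j\<le>n. t * y t < Y j \<omega>)"
    by (simp only: Ball_def atMost_iff)
  then have "{\<omega> \<in> space M. \<forall>j\<le>n. t * y t < Y j \<omega>} \<in> sets M"
    by (simp only: pred_def)
  then have "(\<lambda>\<omega>. if \<forall>j\<le>n. t * y t < Y j \<omega> then Y n \<omega> else 0) \<in> borel_measurable M"
    by (rule measurable_If[OF m[OF order_refl] borel_measurable_const])
  moreover have "(if \<forall>j\<le>n. t * y t < Y j \<omega> then Y n \<omega> else 0) \<in> {0..}" if "\<omega> \<in> space M" for \<omega>
    using nn[OF order_refl that] by simp
  ultimately show ?thesis
    unfolding extremal_component_eq by (intro measurable_restrict_space2) blast+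
qed

text \<open>Time \<open>0\<close> is included because the induction over the length of the path
  starts from the initial state. The restriction makes the path a point of the product space over
  \<open>{..k}\<close>.\<close>

definition scaled_path :: "(real \<Rightarrow> real) \<Rightarrow> real \<Rightarrow> nat \<Rightarrow> (nat \<Rightarrow> real) \<Rightarrow> nat \<Rightarrow> real" where
  "scaled_path y t k x = (\<lambda>i\<in>{..k}. extremal_component y t x i / t)"

section \<open>Recursion and measurability of the scaled path\<close>

lemma scaled_path_cong:
  "(\<And>j. j \<le> k \<Longrightarrow> x j = x' j) \<Longrightarrow> scaled_path y t k x = scaled_path y t k x'"
  unfolding scaled_path_def by (intro restrict_ext) (auto intro!: extremal_component_cong)

lemma scaled_path_Suc:
  assumes "0 \<le> t * y t" and "0 < t"
  shows "scaled_path y t (Suc k) x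
    = (scaled_path y t k x)(Suc k := next_state t (t * y t) (scaled_path y t k x k) (x (Suc k)))"
  using extremal_component_Suc[of t y x k, OF assms] by (auto simp: scaled_path_def fun_eq_iff)

lemma measurable_nonneg_borel_divide:
  "f \<in> M \<rightarrow>\<^sub>M nonneg_borel \<Longrightarrow> 0 \<le> t \<Longrightarrow> (\<lambda>x. f x / t) \<in> M \<rightarrow>\<^sub>M nonneg_borel"
  by (auto simp: measurable_restrict_space2_iff Pi_iff)

lemma measurable_scaled_path:
  assumes "\<And>j. j \<le> k \<Longrightarrow> Y j \<in> M \<rightarrow>\<^sub>M nonneg_borel" and "0 < t"
  shows "(\<lambda>\<omega>. scaled_path y t k (\<lambda>j. Y j \<omega>)) \<in> M \<rightarrow>\<^sub>M Pi\<^sub>M {..k} (\<lambda>_. nonneg_borel)"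
  unfolding scaled_path_def using assms
  by (intro measurable_restrict measurable_nonneg_borel_divide measurable_extremal_component) auto

lemma measurable_next_state:
  assumes f: "f \<in> M \<rightarrow>\<^sub>M nonneg_borel" and g: "g \<in> M \<rightarrow>\<^sub>M nonneg_borel" and "0 < t"
  shows "(\<lambda>x. next_state t c (f x) (g x)) \<in> M \<rightarrow>\<^sub>M nonneg_borel"
proof -
  have [measurable]: "f \<in> borel_measurable M" "g \<in> borel_measurable M"
    and "\<And>x. x \<in> space M \<Longrightarrow> 0 \<le> g x"
    using f g by (auto simp: measurable_restrict_space2_iff)
  then show ?thesis
    using \<open>0 < t\<close> unfolding next_state_def by (intro measurable_restrict_space2) auto
qed

lemma measurable_fun_upd_atMost_Suc:
  assumes "f \<in> M \<rightarrow>\<^sub>M Pi\<^sub>M {..k} (\<lambda>_. N)" and "g \<in> M \<rightarrow>\<^sub>M N"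
  shows "(\<lambda>x. (f x)(Suc k := g x)) \<in> M \<rightarrow>\<^sub>M Pi\<^sub>M {..Suc k} (\<lambda>_. N)"
  using measurable_compose[OF measurable_Pair[OF assms] measurable_add_dim[of "Suc k" "{..k}" "\<lambda>_. N"]]
  by (simp add: atMost_Suc)

section \<open>Measurability and recursion of the tail chain\<close>

lemma tail_chain_measurable:
  assumes "tail_chain_family \<Omega> G Q T \<xi>"
  shows "T n \<in> \<Omega> \<rightarrow>\<^sub>M nonneg_borel"
proof -
  have T0: "T 0 \<in> \<Omega> \<rightarrow>\<^sub>M nonneg_borel" and \<xi>: "\<And>i. 1 \<le> i \<Longrightarrow> \<xi> i \<in> \<Omega> \<rightarrow>\<^sub>M nonneg_borel"
    and eq: "\<And>n \<omega>. \<omega> \<in> space \<Omega> \<Longrightarrow> T n \<omega> = T 0 \<omega> * (\<Prod>i=1..n. \<xi> i \<omega>)"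
    using assms unfolding tail_chain_family_def by blast+
  have "(\<lambda>\<omega>. T 0 \<omega> * (\<Prod>i=1..n. \<xi> i \<omega>)) \<in> \<Omega> \<rightarrow>\<^sub>M nonneg_borel"
  proof (induction n)
    case 0
    then show ?case using T0 by simp
  next
    case (Suc n)
    from measurable_nonneg_borel_times[OF Suc \<xi>[of "Suc n"]] show ?case
      by (simp add: mult.assoc)
  qed
  then show ?thesis
    by (rule measurable_cong[THEN iffD2, rotated]) (rule eq)
qed

lemma tail_chain_Suc:
  assumes "tail_chain_family \<Omega> G Q T \<xi>" and \<omega>: "\<omega> \<in> space \<Omega>"
  shows "T (Suc n) \<omega> = T n \<omega> * \<xi> (Suc n) \<omega>"
proof -
  have eq: "\<And>n. T n \<omega> = T 0 \<omega> * (\<Prod>i=1..n. \<xi> i \<omega>)"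
    using assms unfolding tail_chain_family_def by blast
  show ?thesis unfolding eq[of "Suc n"] eq[of n] by simp
qed

text \<open>Integrating out the last step replaces \<open>h n\<close> and \<open>H\<close> by
  functions of a path that is one step shorter, and these satisfy the same hypotheses by the
  one-step limit. The new functions depend on \<open>n\<close> even if the old ones do not, so the
  induction has to run over sequences \<open>h\<close> whose convergence is required only along
  sequences of paths with absorbed limits.\<close>

lemma killed_path_tendsto:
  fixes h :: "nat \<Rightarrow> (nat \<Rightarrow> real) \<Rightarrow> real"
  assumes K: "K \<in> nonneg_borel \<rightarrow>\<^sub>M prob_algebra nonneg_borel"
    and G: "G \<in> space (prob_algebra nonneg_borel)"
    and doa: "in_domain_of_attraction K G" and ub: "uniform_extremal_boundary K G y"
    and t: "strict_mono t" "filterlim t at_top sequentially" "\<And>n. 0 < t n"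
    and mc: "markov_chain_family \<Omega> K P X" and tc: "tail_chain_family \<Omega>' G Q T \<xi>"
    and u: "\<And>n. 0 \<le> u n" "u \<longlonglongrightarrow> v" and v: "0 < v"
    and h: "\<And>n. h n \<in> borel_measurable (Pi\<^sub>M {..k} (\<lambda>_. nonneg_borel))"
    and H: "H \<in> borel_measurable (Pi\<^sub>M {..k} (\<lambda>_. nonneg_borel))"
    and bd: "\<And>n w. \<bar>h n w\<bar> \<le> C" "\<And>w. \<bar>H w\<bar> \<le> C"
    and conv: "\<And>w \<zeta>. (\<And>n. w n \<in> extensional {..k}) \<Longrightarrow> \<zeta> \<in> extensional {..k} \<Longrightarrow>
      (\<And>i. i \<le> k \<Longrightarrow> absorbed_lim (\<lambda>n. w n i) (\<zeta> i)) \<Longrightarrow> (\<lambda>n. h n (w n)) \<longlonglongrightarrow> H \<zeta>"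
  shows "(\<lambda>n. \<integral>\<omega>. h n (scaled_path y (t n) k (\<lambda>j. X j \<omega>)) \<partial>P (t n * u n)) \<longlonglongrightarrow>
    (\<integral>\<omega>. H (\<lambda>i\<in>{..k}. T i \<omega>) \<partial>Q v)"
  using h H bd conv
proof (induction k arbitrary: h H)
  case (0 h H)
  have X [measurable]: "X j \<in> \<Omega> \<rightarrow>\<^sub>M nonneg_borel" for j
    using mc unfolding markov_chain_family_def by blast
  \<comment> \<open>\<open>e n\<close> is the initial state in units of \<open>t n\<close> after
    possible killing at time \<open>0\<close>. As \<open>v\<close> is positive and the boundary
    tends to \<open>0\<close>, it eventually agrees with \<open>u n\<close>.\<close>
  define e where "e n = (if u n \<le> y (t n) then 0 else u n)" for n
  have y_lim: "(\<lambda>n. y (t n)) \<longlonglongrightarrow> 0"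
    using ub t(2)
    by (auto simp: uniform_extremal_boundary_def extremal_boundary_def intro: filterlim_compose)
  have "\<forall>\<^sub>F n in sequentially. 0 < u n - y (t n)"
    using order_tendstoD(1)[OF tendsto_diff[OF u(2) y_lim], of 0] v by simp
  then have "\<forall>\<^sub>F n in sequentially. u n = e n"
    by eventually_elim (simp add: e_def)
  then have "e \<longlonglongrightarrow> v"
    using u(2) by (rule Lim_transform_eventually[rotated])
  then have e: "absorbed_lim e v"
    using v u(1) by (simp add: absorbed_lim_def e_def)
  have "(\<lambda>n. h n (\<lambda>i\<in>{..0}. e n)) \<longlonglongrightarrow> H (\<lambda>i\<in>{..0}. v)"
    by (rule 0) (use e in \<open>auto simp: extensional_def\<close>)
  moreover have "(\<integral>\<omega>. h n (scaled_path y (t n) 0 (\<lambda>j. X j \<omega>)) \<partial>P (t n * u n)) = h n (\<lambda>i\<in>{..0}. e n)" for n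
  proof -
    have nn: "0 \<le> t n * u n" using t(3)[of n] u(1)[of n] by simp
    have sets_P: "sets (P (t n * u n)) = sets \<Omega>" and "prob_space (P (t n * u n))"
      and AE_X0: "AE \<omega> in P (t n * u n). X 0 \<omega> = t n * u n"
      using mc nn by (auto simp: markov_chain_family_def space_prob_algebra)
    then interpret prob_space "P (t n * u n)" by simp
    have "(\<integral>\<omega>. h n (scaled_path y (t n) 0 (\<lambda>j. X j \<omega>)) \<partial>P (t n * u n))
        = (\<integral>\<omega>. h n (\<lambda>i\<in>{..0}. e n) \<partial>P (t n * u n))"
    proof (rule integral_cong_AE)
      show "(\<lambda>\<omega>. h n (scaled_path y (t n) 0 (\<lambda>j. X j \<omega>))) \<in> borel_measurable (P (t n * u n))"
        unfolding measurable_cong_sets[OF sets_P refl]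
        by (rule measurable_compose[OF measurable_scaled_path 0(1)]) (use X t(3) in auto)
      show "AE \<omega> in P (t n * u n). h n (scaled_path y (t n) 0 (\<lambda>j. X j \<omega>)) = h n (\<lambda>i\<in>{..0}. e n)"
        using AE_X0
      proof eventually_elim
        case (elim \<omega>)
        have "scaled_path y (t n) 0 (\<lambda>j. X j \<omega>) = (\<lambda>i\<in>{..0}. e n)"
          using elim t(3)[of n] by (auto simp: scaled_path_def extremal_component_0 e_def intro!: restrict_ext)
        then show ?case by simp
      qed
    qed simp
    then show ?thesis by (simp add: prob_space)
  qed
  moreover have "(\<integral>\<omega>. H (\<lambda>i\<in>{..0}. T i \<omega>) \<partial>Q v) = H (\<lambda>i\<in>{..0}. v)"
  proof -
    have sets_Q: "sets (Q v) = sets \<Omega>'" and "prob_space (Q v)" and AE_T0: "AE \<omega> in Q v. T 0 \<omega> = v"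
      using tc v unfolding tail_chain_family_def space_prob_algebra by (auto dest: less_imp_le)
    then interpret prob_space "Q v" by simp
    have "(\<integral>\<omega>. H (\<lambda>i\<in>{..0}. T i \<omega>) \<partial>Q v) = (\<integral>\<omega>. H (\<lambda>i\<in>{..0}. v) \<partial>Q v)"
    proof (rule integral_cong_AE)
      show "(\<lambda>\<omega>. H (\<lambda>i\<in>{..0}. T i \<omega>)) \<in> borel_measurable (Q v)"
        unfolding measurable_cong_sets[OF sets_Q refl]
        by (rule measurable_compose[OF measurable_restrict 0(2)]) (rule tail_chain_measurable[OF tc])
      show "AE \<omega> in Q v. H (\<lambda>i\<in>{..0}. T i \<omega>) = H (\<lambda>i\<in>{..0}. v)"
        using AE_T0
      proof eventually_elim
        case (elim \<omega>)
        have "(\<lambda>i\<in>{..0}. T i \<omega>) = (\<lambda>i\<in>{..0}. v)"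
          using elim by (auto intro!: restrict_ext)
        then show ?case by simp
      qed
    qed simp
    then show ?thesis by (simp add: prob_space)
  qed
  ultimately show ?case by (simp only:)
next
  case (Suc k h H)
  let ?E = "Pi\<^sub>M {..k} (\<lambda>_. nonneg_borel)"
  define c where "c n = t n * y (t n)" for n
  have c_nonneg: "0 \<le> c n" for n
    using ub t(3)[of n] by (simp add: c_def uniform_extremal_boundary_def extremal_boundary_def)
  \<comment> \<open>The absolute value makes \<open>g n\<close> bounded also off the carrier, where \<open>K\<close> is unspecified.\<close>
  define g where "g n w = (\<integral>x. h n (w(Suc k := next_state (t n) (c n) (w k) x)) \<partial>K (t n * \<bar>w k\<bar>))" for n w
  define ginf where "ginf w = (\<integral>x. H (w(Suc k := w k * x)) \<partial>G)" for w
  have X: "X j \<in> \<Omega> \<rightarrow>\<^sub>M nonneg_borel" for j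
    using mc unfolding markov_chain_family_def by blast
  have g_meas: "g n \<in> borel_measurable ?E" for n
    unfolding g_def
  proof (rule borel_measurable_integral_kernel)
    show "(\<lambda>(w, x). h n (w(Suc k := next_state (t n) (c n) (w k) x))) \<in> borel_measurable (?E \<Otimes>\<^sub>M nonneg_borel)"
      unfolding case_prod_beta using t(3)
      by (intro measurable_compose[OF measurable_fun_upd_atMost_Suc Suc.prems(1)] measurable_next_state
          measurable_fst measurable_snd measurable_compose[OF measurable_fst measurable_component_singleton]) auto
    have "(\<lambda>w. t n * w k) \<in> ?E \<rightarrow>\<^sub>M nonneg_borel"
      using t(3)[of n] by (intro measurable_nonneg_borel_times measurable_component_singleton) auto
    then have "(\<lambda>w. t n * \<bar>w k\<bar>) \<in> ?E \<rightarrow>\<^sub>M nonneg_borel"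
      by (rule measurable_cong[THEN iffD2, rotated]) (auto simp: space_PiM PiE_iff)
    then show "(\<lambda>w. K (t n * \<bar>w k\<bar>)) \<in> ?E \<rightarrow>\<^sub>M prob_algebra nonneg_borel"
      using K by (rule measurable_compose)
  qed
  have H_step: "(\<lambda>p. H ((fst p)(Suc k := fst p k * snd p))) \<in> borel_measurable (?E \<Otimes>\<^sub>M nonneg_borel)"
    by (intro measurable_compose[OF measurable_fun_upd_atMost_Suc Suc.prems(2)] measurable_nonneg_borel_times
        measurable_fst measurable_snd measurable_compose[OF measurable_fst measurable_component_singleton]) auto
  have ginf_meas: "ginf \<in> borel_measurable ?E"
    unfolding ginf_def using G H_step
    by (intro borel_measurable_integral_kernel[where N=nonneg_borel]) (simp_all add: case_prod_beta)
  \<comment> \<open>Measurability is not assumed of \<open>f\<close>: if \<open>f\<close> is not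
    integrable, its integral is \<open>0\<close> by convention and the bound holds because
    \<open>C\<close> is nonnegative.\<close>
  have integral_bound: "\<bar>\<integral>x. f x \<partial>M\<bar> \<le> C" if M: "prob_space M" and f: "\<And>x. \<bar>f x\<bar> \<le> C"
    for M :: "real measure" and f :: "real \<Rightarrow> real"
  proof -
    interpret prob_space M by fact
    show ?thesis
    proof (cases "integrable M f")
      case True
      then have "\<bar>\<integral>x. f x \<partial>M\<bar> \<le> (\<integral>x. C \<partial>M)"
        using f by (intro order_trans[OF integral_abs_bound] integral_mono) auto
      then show ?thesis by (simp add: prob_space)
    next
      case False
      then show ?thesis using f[of 0] by (simp add: not_integrable_integral_eq)
    qed
  qed
  have K_prob: "prob_space (K x)" if "0 \<le> x" for x
    using measurable_space[OF K, of x] that by (simp add: space_prob_algebra)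
  have G_prob: "prob_space G"
    using G by (simp add: space_prob_algebra)
  have g_bd: "\<bar>g n w\<bar> \<le> C" for n w
    unfolding g_def using t(3)[of n] by (intro integral_bound K_prob Suc.prems(3)) auto
  have ginf_bd: "\<bar>ginf w\<bar> \<le> C" for w
    unfolding ginf_def by (intro integral_bound G_prob Suc.prems(4))
  have step_X: "(\<integral>\<omega>. h n (scaled_path y (t n) (Suc k) (\<lambda>j. X j \<omega>)) \<partial>P (t n * u n))
      = (\<integral>\<omega>. g n (scaled_path y (t n) k (\<lambda>j. X j \<omega>)) \<partial>P (t n * u n))" for n
  proof -
    have nn: "0 \<le> t n * u n" using t(3)[of n] u(1)[of n] by simp
    have sets_P: "sets (P (t n * u n)) = sets \<Omega>"
      using mc nn by (auto simp: markov_chain_family_def space_prob_algebra)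
    define S where "S = scaled_path y (t n) k"
    define \<phi> where "\<phi> p = h n ((S (fst p))(Suc k := next_state (t n) (c n) (S (fst p) k) (snd p)))"
      for p :: "(nat \<Rightarrow> real) \<times> real"
    have S_meas: "(\<lambda>p. S (fst p)) \<in> ?E \<Otimes>\<^sub>M nonneg_borel \<rightarrow>\<^sub>M ?E"
      unfolding S_def using t(3)[of n]
      by (intro measurable_scaled_path[of k "\<lambda>j p. fst p j"]
          measurable_compose[OF measurable_fst measurable_component_singleton]) auto
    have \<phi>_meas: "\<phi> \<in> borel_measurable (?E \<Otimes>\<^sub>M nonneg_borel)"
      unfolding \<phi>_def using t(3)[of n]
      by (intro measurable_compose[OF measurable_fun_upd_atMost_Suc Suc.prems(1)] measurable_next_state
          S_meas measurable_snd measurable_compose[OF S_meas measurable_component_singleton]) auto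
    have S_restrict: "S (\<lambda>j\<in>{..k}. X j \<omega>) = S (\<lambda>j. X j \<omega>)" for \<omega>
      unfolding S_def by (rule scaled_path_cong) simp
    have "(\<integral>\<omega>. h n (scaled_path y (t n) (Suc k) (\<lambda>j. X j \<omega>)) \<partial>P (t n * u n))
        = (\<integral>\<omega>. \<phi> (\<lambda>j\<in>{..k}. X j \<omega>, X (Suc k) \<omega>) \<partial>P (t n * u n))"
      using scaled_path_Suc[OF _ t(3), of n y k] c_nonneg[of n]
      by (simp add: \<phi>_def S_restrict) (simp add: S_def c_def)
    also have "\<dots> = (\<integral>\<omega>. (\<integral>z. \<phi> (\<lambda>j\<in>{..k}. X j \<omega>, z) \<partial>K (X k \<omega>)) \<partial>P (t n * u n))"
      by (rule markov_chain_integral[OF mc K nn \<phi>_meas, of C]) (simp add: \<phi>_def Suc.prems(3))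
    also have "\<dots> = (\<integral>\<omega>. g n (S (\<lambda>j. X j \<omega>)) \<partial>P (t n * u n))"
    proof (intro Bochner_Integration.integral_cong refl)
      fix \<omega> assume "\<omega> \<in> space (P (t n * u n))"
      then have \<omega>: "\<omega> \<in> space \<Omega>" using sets_eq_imp_space_eq[OF sets_P] by simp
      then have X_nn: "0 \<le> X k \<omega>" using measurable_space[OF X[of k]] by auto
      show "(\<integral>z. \<phi> (\<lambda>j\<in>{..k}. X j \<omega>, z) \<partial>K (X k \<omega>)) = g n (S (\<lambda>j. X j \<omega>))"
      \<comment> \<open>Once the path is killed, the next scaled state is \<open>0\<close> whatever
        is drawn, so both integrals are of the same constant even though one kernel starts at
        \<open>X k \<omega>\<close> and the other at \<open>0\<close>. Before killing,
        \<open>t n\<close> times the scaled state is the true state \<open>X k \<omega>\<close>, and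
        the kernels coincide.\<close>
      proof (cases "extremal_component y (t n) (\<lambda>j. X j \<omega>) k = 0")
        case True
        then have S0: "S (\<lambda>j. X j \<omega>) k = 0" by (simp add: S_def scaled_path_def)
        show ?thesis
          using prob_space.prob_space[OF K_prob[OF X_nn]] prob_space.prob_space[OF K_prob[OF order_refl]]
          by (simp add: \<phi>_def g_def S_restrict S0 next_state_def)
      next
        case False
        then have "S (\<lambda>j. X j \<omega>) k = X k \<omega> / t n"
          by (auto simp: S_def scaled_path_def extremal_component_eq split: if_splits)
        then have "t n * \<bar>S (\<lambda>j. X j \<omega>) k\<bar> = X k \<omega>"
          using t(3)[of n] X_nn by simp
        then show ?thesis by (simp add: \<phi>_def g_def S_restrict)
      qed
    qed
    finally show ?thesis by (simp add: S_def)
  qed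
  have step_T: "(\<integral>\<omega>. H (\<lambda>i\<in>{..Suc k}. T i \<omega>) \<partial>Q v) = (\<integral>\<omega>. ginf (\<lambda>i\<in>{..k}. T i \<omega>) \<partial>Q v)"
  proof -
    have "sets (Q v) = sets \<Omega>'"
      using tc v unfolding tail_chain_family_def space_prob_algebra by (auto dest: less_imp_le)
    then have space_Q: "space (Q v) = space \<Omega>'" by (rule sets_eq_imp_space_eq)
    define \<phi> where "\<phi> p = H ((fst p)(Suc k := fst p k * snd p))" for p :: "(nat \<Rightarrow> real) \<times> real"
    have "(\<integral>\<omega>. H (\<lambda>i\<in>{..Suc k}. T i \<omega>) \<partial>Q v) = (\<integral>\<omega>. \<phi> (\<lambda>i\<in>{..k}. T i \<omega>, \<xi> (Suc k) \<omega>) \<partial>Q v)"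
    proof (intro Bochner_Integration.integral_cong refl)
      fix \<omega> assume "\<omega> \<in> space (Q v)"
      then have "(\<lambda>i\<in>{..Suc k}. T i \<omega>) = (\<lambda>i\<in>{..k}. T i \<omega>)(Suc k := T k \<omega> * \<xi> (Suc k) \<omega>)"
        using tail_chain_Suc[OF tc, of \<omega> k] by (auto simp: space_Q fun_eq_iff)
      then show "H (\<lambda>i\<in>{..Suc k}. T i \<omega>) = \<phi> (\<lambda>i\<in>{..k}. T i \<omega>, \<xi> (Suc k) \<omega>)"
        by (simp add: \<phi>_def)
    qed
    also have "\<dots> = (\<integral>\<omega>. (\<integral>z. \<phi> (\<lambda>i\<in>{..k}. T i \<omega>, z) \<partial>G) \<partial>Q v)"
      using v H_step by (intro tail_chain_integral[OF tc G, where C=C]) (auto simp: \<phi>_def Suc.prems(4))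
    finally show ?thesis by (simp add: \<phi>_def ginf_def)
  qed
  have g_conv: "(\<lambda>n. g n (w n)) \<longlonglongrightarrow> ginf \<zeta>"
    if w: "\<And>n. w n \<in> extensional {..k}" and \<zeta>: "\<zeta> \<in> extensional {..k}"
      and lim: "\<And>i. i \<le> k \<Longrightarrow> absorbed_lim (\<lambda>n. w n i) (\<zeta> i)" for w \<zeta>
  proof -
    have w_space: "w n \<in> space ?E" for n
      using w[of n] lim by (auto simp: space_PiM PiE_iff absorbed_lim_def)
    have \<zeta>_space: "\<zeta> \<in> space ?E"
      using \<zeta> lim[THEN absorbed_lim_nonneg] by (auto simp: space_PiM PiE_iff)
    have upd: "(\<lambda>z. w(Suc k := z)) \<in> nonneg_borel \<rightarrow>\<^sub>M Pi\<^sub>M {..Suc k} (\<lambda>_. nonneg_borel)"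
      if "w \<in> space ?E" for w
      using that by (intro measurable_fun_upd_atMost_Suc measurable_const) auto
    \<comment> \<open>The first coordinates are carried along as parameters: only the last one moves
      in the one-step limit, and the extended paths again have absorbed limits in every
      coordinate.\<close>
    have "(\<lambda>n. \<integral>x. h n ((w n)(Suc k := next_state (t n) (t n * y (t n)) (w n k) x)) \<partial>K (t n * w n k))
      \<longlonglongrightarrow> (\<integral>x. H (\<zeta>(Suc k := \<zeta> k * x)) \<partial>G)"
    proof (rule killed_step_tendsto[OF K G doa ub t lim[OF order_refl],
        where h="\<lambda>n z. h n ((w n)(Suc k := z))" and H="\<lambda>z. H (\<zeta>(Suc k := z))" and C=C])
      show "(\<lambda>z. h n ((w n)(Suc k := z))) \<in> borel_measurable nonneg_borel" for n
        by (rule measurable_compose[OF upd[OF w_space] Suc.prems(1)])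
      show "(\<lambda>z. H (\<zeta>(Suc k := z))) \<in> borel_measurable nonneg_borel"
        by (rule measurable_compose[OF upd[OF \<zeta>_space] Suc.prems(2)])
      fix z \<eta> assume z: "absorbed_lim z \<eta>"
      show "(\<lambda>n. h n ((w n)(Suc k := z n))) \<longlonglongrightarrow> H (\<zeta>(Suc k := \<eta>))"
        using w \<zeta> lim z by (intro Suc.prems(5)) (auto simp: extensional_def le_Suc_eq)
    qed (rule Suc.prems)+
    moreover have "\<bar>w n k\<bar> = w n k" for n
      using lim[of k] by (simp add: absorbed_lim_def)
    ultimately show ?thesis
      by (simp add: g_def ginf_def c_def)
  qed
  show ?case
    unfolding step_X step_T by (rule Suc.IH[OF g_meas ginf_meas g_bd ginf_bd g_conv])
qed

section \<open>Weak convergence on the product space\<close>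

text \<open>If convergence fails, there are points arbitrarily far out whose values stay a fixed
  distance from \<open>L\<close>. Choosing them at least \<open>1\<close> and at least one unit
  apart makes the sequence positive, strictly increasing and divergent. Sequences are wanted because
  the coupling and dominated convergence work along them.\<close>

lemma tendsto_at_top_strict_monoI:
  fixes f :: "real \<Rightarrow> 'a::metric_space"
  assumes *: "\<And>t. strict_mono t \<Longrightarrow> filterlim t at_top sequentially \<Longrightarrow> (\<And>n. 0 < t n) \<Longrightarrow> (\<lambda>n. f (t n)) \<longlonglongrightarrow> L"
  shows "(f \<longlongrightarrow> L) at_top"
proof (rule ccontr)
  assume "\<not> (f \<longlongrightarrow> L) at_top"
  then obtain e where e: "0 < e" and "\<not> (\<forall>\<^sub>F x in at_top. dist (f x) L < e)"
    by (auto simp: tendsto_iff)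
  then have far: "\<exists>x\<ge>r. e \<le> dist (f x) L" for r
    by (auto simp: eventually_at_top_linorder not_less)
  have "\<exists>t. \<forall>n. (1 \<le> t n \<and> e \<le> dist (f (t n)) L) \<and> t n + 1 \<le> t (Suc n)"
    using far[of 1] far by (intro dependent_nat_choice) (meson max.boundedE)+
  then obtain t where t: "\<And>n. 1 \<le> t n" "\<And>n. e \<le> dist (f (t n)) L" "\<And>n. t n + 1 \<le> t (Suc n)"
    by auto
  have "strict_mono t"
    unfolding strict_mono_Suc_iff using t(3) by (metis add_le_same_cancel1 le_less_linear less_le_trans linorder_not_le not_one_le_zero order_trans)
  moreover have "real n \<le> t n" for n
    by (induction n) (use t(1)[of 0] t(3) in \<open>auto intro: order_trans[OF _ t(3)]\<close>)
  then have "filterlim t at_top sequentially"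
    by (intro filterlim_at_top_mono[OF filterlim_real_sequentially]) auto
  moreover have "0 < t n" for n using t(1)[of n] by simp
  ultimately have "(\<lambda>n. f (t n)) \<longlonglongrightarrow> L" by (rule *)
  from tendstoD[OF this e] obtain n where "dist (f (t n)) L < e"
    by (auto simp: eventually_sequentially)
  then show False using t(2)[of n] by simp
qed

text \<open>Composed with restriction to \<open>I\<close>, the map becomes continuous on the whole
  function space. There the index type is countable and the factors are second countable, so a map
  into it that is measurable in each coordinate is Borel measurable.\<close>

lemma borel_measurable_continuous_map_PiM:
  fixes f :: "('i::countable \<Rightarrow> 'b::second_countable_topology) \<Rightarrow> real"
  assumes f: "continuous_map (product_topology (\<lambda>_. euclidean) I) euclideanreal f"
  shows "f \<in> borel_measurable (Pi\<^sub>M I (\<lambda>_. borel))"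
proof -
  define F where "F x = f (restrict x I)" for x
  have "continuous_map (product_topology (\<lambda>_. euclidean) UNIV) (product_topology (\<lambda>_. euclidean) I)
      (\<lambda>x::'i \<Rightarrow> 'b. restrict x I)"
    by (auto simp: continuous_map_componentwise intro: continuous_map_product_projection)
  from continuous_map_compose[OF this f] have "continuous_on UNIV F"
    by (simp add: F_def[abs_def] o_def euclidean_product_topology)
  then have F: "F \<in> borel_measurable borel"
    by (rule borel_measurable_continuous_onI)
  \<comment> \<open>Points of the product space over \<open>I\<close> are already
    \<open>undefined\<close> off \<open>I\<close>, so this embedding into the full function space
    changes nothing on them.\<close>
  have "(\<lambda>x i. if i \<in> I then x i else undefined) \<in> borel_measurable (Pi\<^sub>M I (\<lambda>_. borel :: 'b measure))"
  proof (rule measurable_coordinatewise_then_product)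
    fix i
    show "(\<lambda>x. if i \<in> I then x i else undefined) \<in> borel_measurable (Pi\<^sub>M I (\<lambda>_. borel :: 'b measure))"
      by (cases "i \<in> I") auto
  qed
  from measurable_compose[OF this F] show ?thesis
    by (rule measurable_cong[THEN iffD1, rotated])
       (auto simp: F_def space_PiM PiE_def intro!: arg_cong[where f=f] extensionalityI[of _ I])
qed

lemma integral_joint_law:
  fixes f :: "(nat \<Rightarrow> ennreal) \<Rightarrow> real"
  assumes f: "f \<in> borel_measurable (Pi\<^sub>M {1..m} (\<lambda>_. borel))"
    and Y: "\<And>n. Y n \<in> M \<rightarrow>\<^sub>M nonneg_borel"
  shows "(\<integral>x. f x \<partial>joint_law m M Y) = (\<integral>\<omega>. f (\<lambda>n\<in>{1..m}. ennreal (Y n \<omega>)) \<partial>M)"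
  unfolding joint_law_def
proof (rule integral_distr[OF measurable_restrict f])
  fix n
  have "Y n \<in> borel_measurable M"
    using Y[of n] by (simp add: measurable_restrict_space2_iff)
  then show "(\<lambda>\<omega>. ennreal (Y n \<omega>)) \<in> borel_measurable M" by measurable
qed

lemma continuous_map_product_tendsto:
  fixes f :: "('i \<Rightarrow> 'b::topological_space) \<Rightarrow> real"
  assumes f: "continuous_map (product_topology (\<lambda>_. euclidean) I) euclideanreal f"
    and lim: "\<And>i. i \<in> I \<Longrightarrow> (\<lambda>n. x n i) \<longlonglongrightarrow> l i"
  shows "(\<lambda>n. f (\<lambda>i\<in>I. x n i)) \<longlonglongrightarrow> f (\<lambda>i\<in>I. l i)"
proof -
  have "limitin (product_topology (\<lambda>_. euclidean) I) (\<lambda>n. \<lambda>i\<in>I. x n i) (\<lambda>i\<in>I. l i) sequentially"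
    using lim by (auto simp: limitin_componentwise limitin_canonical_iff cong: restrict_cong)
  from continuous_map_limit[OF f this] show ?thesis
    by (simp add: o_def limitin_canonical_iff)
qed

theorem theorem3p3:
  fixes G :: "real measure" and K :: "real \<Rightarrow> real measure"
    and y u :: "real \<Rightarrow> real" and v :: real and m :: nat
    and \<Omega> :: "'a measure" and P :: "real \<Rightarrow> 'a measure" and X :: "nat \<Rightarrow> 'a \<Rightarrow> real"
    and \<Omega>' :: "'b measure" and Q :: "real \<Rightarrow> 'b measure" and T \<xi> :: "nat \<Rightarrow> 'b \<Rightarrow> real"
  assumes "G \<in> space (prob_algebra nonneg_borel)"
    and "K \<in> nonneg_borel \<rightarrow>\<^sub>M prob_algebra nonneg_borel"
    and "markov_chain_family \<Omega> K P X"
    and "in_domain_of_attraction K G"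
    and "uniform_extremal_boundary K G y"
    and "tail_chain_family \<Omega>' G Q T \<xi>"
    and "\<forall>t\<ge>0. 0 \<le> u t" and "0 < v" and "(u \<longlongrightarrow> v) at_top"
    and "1 \<le> m"
  shows "weak_conv_along (product_topology (\<lambda>_. euclidean :: ennreal topology) {1..m})
           (\<lambda>t. joint_law m (P (t * u t))
              (\<lambda>n \<omega>. extremal_component y t (\<lambda>k. X k \<omega>) n / t))
           (joint_law m (Q v) T) at_top"
  unfolding weak_conv_along_def
proof (intro allI impI, elim conjE, rule tendsto_at_top_strict_monoI)
  fix f :: "(nat \<Rightarrow> ennreal) \<Rightarrow> real" and t :: "nat \<Rightarrow> real"
  assume f: "continuous_map (product_topology (\<lambda>_. euclidean) {1..m}) euclideanreal f"
    and "bounded (f ` topspace (product_topology (\<lambda>_. euclidean) {1..m}))"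
    and t: "strict_mono t" "filterlim t at_top sequentially" "\<And>n. 0 < t n"
  then obtain C where C: "\<And>x. x \<in> PiE {1..m} (\<lambda>_. UNIV) \<Longrightarrow> \<bar>f x\<bar> \<le> C"
    by (auto simp: bounded_iff)
  \<comment> \<open>\<open>H\<close> reads \<open>f\<close> off a real path indexed from
    \<open>0\<close>, ignoring the initial state. Its argument to \<open>f\<close> always lies in
    the product space, so it inherits the bound at every \<open>w\<close>.\<close>
  define H where "H w = f (\<lambda>i\<in>{1..m}. ennreal (w i))" for w :: "nat \<Rightarrow> real"
  have H_bd: "\<bar>H w\<bar> \<le> C" for w
    unfolding H_def by (rule C) auto
  have f_meas: "f \<in> borel_measurable (Pi\<^sub>M {1..m} (\<lambda>_. borel))"
    by (rule borel_measurable_continuous_map_PiM[OF f])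
  have ennreal_meas: "ennreal \<in> borel_measurable nonneg_borel"
    by (rule measurable_restrict_space1) simp
  have H_meas: "H \<in> borel_measurable (Pi\<^sub>M {..m} (\<lambda>_. nonneg_borel))"
    unfolding H_def
  proof (rule measurable_compose[OF measurable_restrict f_meas])
    fix i assume "i \<in> {1..m}"
    then have "(\<lambda>w. w i) \<in> Pi\<^sub>M {..m} (\<lambda>_. nonneg_borel) \<rightarrow>\<^sub>M nonneg_borel"
      by (intro measurable_component_singleton) auto
    from measurable_compose[OF this ennreal_meas]
    show "(\<lambda>w. ennreal (w i)) \<in> borel_measurable (Pi\<^sub>M {..m} (\<lambda>_. nonneg_borel))" .
  qed
  have H_conv: "(\<lambda>n. H (w n)) \<longlonglongrightarrow> H \<zeta>" if "\<And>i. i \<le> m \<Longrightarrow> absorbed_lim (\<lambda>n. w n i) (\<zeta> i)" for w \<zeta>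
    unfolding H_def using that
    by (intro continuous_map_product_tendsto[OF f] tendsto_ennrealI) (auto simp: absorbed_lim_def)
  have X: "X j \<in> \<Omega> \<rightarrow>\<^sub>M nonneg_borel" for j
    using assms(3) unfolding markov_chain_family_def by blast
  \<comment> \<open>The path limit is applied with the constant sequence \<open>h n = H\<close>:
    absorbed limits are in particular coordinatewise limits, along which \<open>f\<close> is
    continuous.\<close>
  have "(\<lambda>n. \<integral>\<omega>. H (scaled_path y (t n) m (\<lambda>j. X j \<omega>)) \<partial>P (t n * u (t n))) \<longlonglongrightarrow>
      (\<integral>\<omega>. H (\<lambda>i\<in>{..m}. T i \<omega>) \<partial>Q v)"
    using assms(7) t(3)
    by (intro killed_path_tendsto[OF assms(2,1,4,5) t assms(3,6) _ filterlim_compose[OF assms(9) t(2)] assms(8)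
        H_meas H_meas H_bd H_bd H_conv]) (auto simp: less_imp_le)
  moreover have "(\<integral>x. f x \<partial>joint_law m (P (t n * u (t n))) (\<lambda>i \<omega>. extremal_component y (t n) (\<lambda>k. X k \<omega>) i / t n))
      = (\<integral>\<omega>. H (scaled_path y (t n) m (\<lambda>j. X j \<omega>)) \<partial>P (t n * u (t n)))" for n
  proof -
    have "0 \<le> t n * u (t n)"
      using assms(7) t(3)[of n] by simp
    then have "sets (P (t n * u (t n))) = sets \<Omega>"
      using assms(3) unfolding markov_chain_family_def space_prob_algebra by blast
    note cong = measurable_cong_sets[OF this refl]
    have "(\<lambda>\<omega>. extremal_component y (t n) (\<lambda>k. X k \<omega>) i / t n) \<in> P (t n * u (t n)) \<rightarrow>\<^sub>M nonneg_borel" for i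
      unfolding cong using t(3)[of n]
      by (intro measurable_nonneg_borel_divide measurable_extremal_component X) auto
    moreover have "(\<lambda>i\<in>{1..m}. ennreal (extremal_component y (t n) x i / t n))
        = (\<lambda>i\<in>{1..m}. ennreal (scaled_path y (t n) m x i))" for x
      by (rule restrict_ext) (simp add: scaled_path_def)
    ultimately show ?thesis
      by (simp only: integral_joint_law[OF f_meas] H_def)
  qed
  moreover have "(\<integral>x. f x \<partial>joint_law m (Q v) T) = (\<integral>\<omega>. H (\<lambda>i\<in>{..m}. T i \<omega>) \<partial>Q v)"
  proof -
    have "sets (Q v) = sets \<Omega>'"
      using assms(6,8) unfolding tail_chain_family_def space_prob_algebra by (blast dest: less_imp_le)
    note cong = measurable_cong_sets[OF this refl]
    have "T i \<in> Q v \<rightarrow>\<^sub>M nonneg_borel" for i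
      unfolding cong by (rule tail_chain_measurable[OF assms(6)])
    moreover have "(\<lambda>i\<in>{1..m}. ennreal (T i \<omega>)) = (\<lambda>i\<in>{1..m}. ennreal ((\<lambda>i\<in>{..m}. T i \<omega>) i))" for \<omega>
      by (rule restrict_ext) simp
    ultimately show ?thesis
      by (simp only: integral_joint_law[OF f_meas] H_def)
  qed
  ultimately show "(\<lambda>n. \<integral>x. f x \<partial>joint_law m (P (t n * u (t n)))
        (\<lambda>i \<omega>. extremal_component y (t n) (\<lambda>k. X k \<omega>) i / t n))
      \<longlonglongrightarrow> (\<integral>x. f x \<partial>joint_law m (Q v) T)"
    by (simp only:)
qed

end
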